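(* Let $k\ge 2$. There exists a linear-time $\left[1 - (1 - 1/k)^{k - 1}\right]$-approximation algorithm for Submodular Welfare with $k$ players having identical non-negative submodular utility functions. Moreover, for every constant $\varepsilon > 0$, any algorithm for this problem whose approximation ratio is $\left[1 - (1 - 1/k)^{k - 1}\right] + \varepsilon$ must use an exponential number of value oracle queries.
   Context: Submodular Welfare: there are $k$ players and a finite set $\mathcal{N}$ of $n$ items; each player $p_i$ has a non-negative submodular utility function $u_{p_i}\colon 2^{\mathcal{N}}\to\mathbb{R}^+$ (submodular: $u(A)+u(B)\ge u(A\cup B)+u(A\cap B)$). The goal is to find a partition $S_1,\dots,S_k$ of $\mathcal{N}$ maximizing $\sum_{i=1}^k u_{p_i}(S_i)$. In the identical-utilities variant all players have the same utility function $f$, accessed via a value oracle returning $f(S)$ for a queried set $S$. An approximation ratio $\alpha$ means the expected value of the output is at least $\alpha$ times the optimum. *)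

theory Defs
  imports "HOL-Probability.Probability" "HOL-Library.Disjoint_Sets"
begin

text \<open>
  The ground set of \<open>n\<close> items is \<open>{..<n}\<close>, the players are \<open>{..<k}\<close>. Bundles of a partition may be
  empty. Utilities are only ever evaluated on subsets of the ground set.
\<close>

definition submodular_on :: "'a set \<Rightarrow> ('a set \<Rightarrow> real) \<Rightarrow> bool" where
  "submodular_on N u \<longleftrightarrow> (\<forall>A B. A \<subseteq> N \<longrightarrow> B \<subseteq> N \<longrightarrow> u A + u B \<ge> u (A \<union> B) + u (A \<inter> B))"

definition utility_on :: "'a set \<Rightarrow> ('a set \<Rightarrow> real) \<Rightarrow> bool" where
  "utility_on N u \<longleftrightarrow> (\<forall>A \<subseteq> N. 0 \<le> u A) \<and> submodular_on N u"

definition allocation :: "nat \<Rightarrow> 'a set \<Rightarrow> (nat \<Rightarrow> 'a set) \<Rightarrow> bool" where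
  "allocation k N S \<longleftrightarrow> (\<Union>i<k. S i) = N \<and> disjoint_family_on S {..<k}"

definition welfare :: "nat \<Rightarrow> (nat \<Rightarrow> 'a set \<Rightarrow> real) \<Rightarrow> (nat \<Rightarrow> 'a set) \<Rightarrow> real" where
  "welfare k u S = (\<Sum>i<k. u i (S i))"

definition opt_welfare :: "nat \<Rightarrow> 'a set \<Rightarrow> (nat \<Rightarrow> 'a set \<Rightarrow> real) \<Rightarrow> real" where
  "opt_welfare k N u = Max (welfare k u ` {S. allocation k N S})"


section \<open>Randomised algorithms with a value oracle\<close>

text \<open>
  An arbitrary randomised algorithm on a fixed ground set is a possibly infinite tree, so that
  neither computability nor termination is built in. Every node except \<open>Output\<close> takes one unit
  of time; \<open>Internal\<close> is a step without interaction.
\<close>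

codatatype alg =
    Output "nat \<Rightarrow> nat set"
  | Query "nat set" "real \<Rightarrow> alg"
  | Random "alg pmf"
  | Internal alg

text \<open>
  Joint law of the output, the number of oracle queries and the number of steps. The missing mass
  is the probability of running forever.
\<close>

partial_function (spmf) run ::
  "(nat set \<Rightarrow> real) \<Rightarrow> alg \<Rightarrow> ((nat \<Rightarrow> nat set) \<times> nat \<times> nat) spmf" where
  "run orc a = (case a of
      Output S \<Rightarrow> return_spmf (S, 0, 0)
    | Query Q c \<Rightarrow> map_spmf (\<lambda>(S, q, t). (S, Suc q, Suc t)) (run orc (c (orc Q)))
    | Random p \<Rightarrow> map_spmf (\<lambda>(S, q, t). (S, q, Suc t)) (bind_spmf (spmf_of_pmf p) (run orc))
    | Internal b \<Rightarrow> map_spmf (\<lambda>(S, q, t). (S, q, Suc t)) (run orc b))"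

text \<open>The intersection makes values of \<open>f\<close> outside the ground set inaccessible.\<close>

definition run_on :: "(nat \<Rightarrow> alg) \<Rightarrow> nat \<Rightarrow> (nat set \<Rightarrow> real) \<Rightarrow>
    ((nat \<Rightarrow> nat set) \<times> nat \<times> nat) spmf" where
  "run_on A n f = run (\<lambda>Q. f (Q \<inter> {..<n})) (A n)"

definition approximation_algorithm :: "nat \<Rightarrow> real \<Rightarrow> (nat \<Rightarrow> alg) \<Rightarrow> bool" where
  "approximation_algorithm k \<alpha> A \<longleftrightarrow>
    (\<forall>n f. utility_on {..<n} f \<longrightarrow>
       lossless_spmf (run_on A n f) \<and>
       (\<forall>(S, q, t) \<in> set_spmf (run_on A n f). allocation k {..<n} S) \<and>
       (\<integral>(S, q, t). welfare k (\<lambda>_. f) S \<partial>measure_spmf (run_on A n f))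
         \<ge> \<alpha> * opt_welfare k {..<n} (\<lambda>_. f))"

definition expected_queries :: "(nat \<Rightarrow> alg) \<Rightarrow> nat \<Rightarrow> (nat set \<Rightarrow> real) \<Rightarrow> ennreal" where
  "expected_queries A n f = (\<integral>\<^sup>+ (S, q, t). of_nat q \<partial>measure_spmf (run_on A n f))"

definition linear_time :: "(nat \<Rightarrow> alg) \<Rightarrow> bool" where
  "linear_time A \<longleftrightarrow>
    (\<exists>C. \<forall>n f. utility_on {..<n} f \<longrightarrow> (\<forall>(S, q, t) \<in> set_spmf (run_on A n f). t \<le> C * n + C))"


section \<open>Random access machines with a value oracle\<close>

text \<open>
  The trees above are non-uniform and compute for free, hence running time is only meaningful for
  trees generated by a fixed finite program. Programs run on a random access machine with
  registers and memory for natural numbers (\<open>reg\<close>, \<open>mem\<close>) and for reals (\<open>rreg\<close>, \<open>rmem\<close>); every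
  instruction has unit cost. In the instructions, operands are register indices, except for the
  literal in \<open>Const\<close> and the jump targets.
\<close>

datatype instr =
    Const nat nat
  | Add nat nat nat
  | Sub nat nat nat
  | Load nat nat
  | Store nat nat
  | JumpLess nat nat nat
  | Uniform nat nat
  | Value nat nat
  | RAdd nat nat nat
  | RSub nat nat nat
  | RMult nat nat nat
  | RDiv nat nat nat
  | RLoad nat nat
  | RStore nat nat
  | RJumpLess nat nat nat
  | Halt

record state =
  pc :: nat
  reg :: "nat \<Rightarrow> nat"
  mem :: "nat \<Rightarrow> nat"
  rreg :: "nat \<Rightarrow> real"
  rmem :: "nat \<Rightarrow> real"

definition fetch :: "instr list \<Rightarrow> state \<Rightarrow> instr" where
  "fetch P s = (if pc s < length P then P ! pc s else Halt)"

abbreviation next_pc :: "state \<Rightarrow> state" where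
  "next_pc s \<equiv> s\<lparr>pc := Suc (pc s)\<rparr>"

definition set_reg :: "nat \<Rightarrow> state \<Rightarrow> nat \<Rightarrow> state" where
  "set_reg i s v = next_pc (s\<lparr>reg := (reg s)(i := v)\<rparr>)"

definition set_rreg :: "nat \<Rightarrow> state \<Rightarrow> real \<Rightarrow> state" where
  "set_rreg i s v = next_pc (s\<lparr>rreg := (rreg s)(i := v)\<rparr>)"

datatype action =
    is_Stop: Stop (stop_output: "nat \<Rightarrow> nat set")
  | is_Ask: Ask (ask_set: "nat set") (ask_cont: "real \<Rightarrow> state")
  | is_Draw: Draw (draw_law: "state pmf")
  | is_Go: Go (go_state: state)

text \<open>
  \<open>Uniform i j\<close> draws from \<open>{0, \<dots>, reg j - 1}\<close> (and yields \<open>0\<close> if \<open>reg j = 0\<close>). \<open>Value i j\<close>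
  queries the set whose characteristic vector is stored in \<open>mem\<close> from address \<open>reg j\<close> on. On
  halting, \<open>mem x\<close> is the player who receives item \<open>x\<close>.
\<close>

fun step :: "nat \<Rightarrow> instr \<Rightarrow> state \<Rightarrow> action" where
  "step n (Const i v) s = Go (set_reg i s v)"
| "step n (Add i j l) s = Go (set_reg i s (reg s j + reg s l))"
| "step n (Sub i j l) s = Go (set_reg i s (reg s j - reg s l))"
| "step n (Load i j) s = Go (set_reg i s (mem s (reg s j)))"
| "step n (Store i j) s = Go (next_pc (s\<lparr>mem := (mem s)(reg s i := reg s j)\<rparr>))"
| "step n (JumpLess i j l) s = Go (if reg s i < reg s j then s\<lparr>pc := l\<rparr> else next_pc s)"
| "step n (Uniform i j) s = Draw (map_pmf (set_reg i s) (pmf_of_set {0..reg s j - 1}))"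
| "step n (Value i j) s = Ask {x. x < n \<and> mem s (reg s j + x) \<noteq> 0} (set_rreg i s)"
| "step n (RAdd i j l) s = Go (set_rreg i s (rreg s j + rreg s l))"
| "step n (RSub i j l) s = Go (set_rreg i s (rreg s j - rreg s l))"
| "step n (RMult i j l) s = Go (set_rreg i s (rreg s j * rreg s l))"
| "step n (RDiv i j l) s = Go (set_rreg i s (rreg s j / rreg s l))"
| "step n (RLoad i j) s = Go (set_rreg i s (rmem s (reg s j)))"
| "step n (RStore i j) s = Go (next_pc (s\<lparr>rmem := (rmem s)(reg s i := rreg s j)\<rparr>))"
| "step n (RJumpLess i j l) s = Go (if rreg s i < rreg s j then s\<lparr>pc := l\<rparr> else next_pc s)"
| "step n Halt s = Stop (\<lambda>p. {x. x < n \<and> mem s x = p})"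

primcorec exec :: "instr list \<Rightarrow> nat \<Rightarrow> state \<Rightarrow> alg" where
  "exec P n s = (case step n (fetch P s) s of
      Stop S \<Rightarrow> Output S
    | Ask Q c \<Rightarrow> Query Q (\<lambda>v. exec P n (c v))
    | Draw p \<Rightarrow> Random (map_pmf (exec P n) p)
    | Go s' \<Rightarrow> Internal (exec P n s'))"

text \<open>Initially register \<open>0\<close> contains the number of items and all other cells are zero.\<close>

definition initial_state :: "nat \<Rightarrow> state" where
  "initial_state n = \<lparr>pc = 0, reg = (\<lambda>_. 0)(0 := n), mem = (\<lambda>_. 0), rreg = (\<lambda>_. 0), rmem = (\<lambda>_. 0)\<rparr>"

definition program_alg :: "instr list \<Rightarrow> nat \<Rightarrow> alg" where
  "program_alg P n = exec P n (initial_state n)"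

end

theory Submission imports Defs begin

text \<open>
  Algorithm: give every item to a uniformly random player, so that each bundle contains each item
  independently with probability \<open>1/k\<close>. Given an optimal allocation \<open>S\<close>, submodularity allows one to
  replace item-wise by block-wise sampling, i.e. to bound the expected value of a bundle from below
  by that of the union of a random subfamily of the blocks. For a non-negative submodular function
  on the \<open>k\<close> blocks, the average over the families of size \<open>j \<ge> 1\<close> is at least \<open>(k - j)/(k - 1)\<close>
  times the average over single blocks; summing over the binomial distribution of \<open>j\<close> yields the ratio.

  Hardness: this is tight for the function with value \<open>0\<close> at the empty family and
  \<open>(k - j)/(k - 1)\<close> at families of size \<open>j \<ge> 1\<close>. Its multilinear extension is
  \<open>k/(k - 1) * (m - \<Prod>i. y i)\<close>, where \<open>y i\<close> is the uncovered fraction of block \<open>i\<close> and \<open>m\<close> is the mean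
  of the \<open>y i\<close>. Hide a random partition by replacing \<open>\<Prod>i. y i\<close> with \<open>m ^ k\<close> whenever the dispersion \<open>D\<close> of
  the \<open>y i\<close> is at most \<open>\<delta>\<close>, interpolating on a logarithmic scale in \<open>D\<close>. Since
  \<open>m ^ k - \<Prod>i. y i = O(D)\<close>, the interpolation perturbs second derivatives arbitrarily little, which a
  small concave quadratic in \<open>m\<close> repairs. A fixed query is unbalanced for a random partition only with
  exponentially small probability, hence with few queries the run agrees with the run on the
  symmetric instance, whose welfare is at most the ratio times the hidden optimum, up to \<open>\<epsilon>\<close>.
\<close>

section \<open>Uniformly random allocation\<close>

text \<open>The multilinear extension on the diagonal: the expectation of \<open>h\<close> on a
  random subset of \<open>A\<close> that keeps each element independently with probability
  \<open>p\<close>. As a finite sum it unfolds one element at a time.\<close>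

definition sampled :: "real \<Rightarrow> 'a set \<Rightarrow> ('a set \<Rightarrow> real) \<Rightarrow> real" where
  "sampled p A h = (\<Sum>B\<in>Pow A. p ^ card B * (1 - p) ^ (card A - card B) * h B)"

lemma sampled_empty [simp]: "sampled p {} h = h {}"
  by (simp add: sampled_def)

lemma sum_Pow_insert:
  fixes h :: "'a set \<Rightarrow> real"
  assumes "finite A" "a \<notin> A"
  shows "(\<Sum>B\<in>Pow (insert a A). h B) = (\<Sum>B\<in>Pow A. h (insert a B)) + (\<Sum>B\<in>Pow A. h B)"
proof -
  have "inj_on (insert a) (Pow A)"
    using assms by (auto simp: inj_on_def)
  moreover have "Pow A \<inter> insert a ` Pow A = {}"
    using assms by auto
  ultimately show ?thesis
    using assms by (simp add: Pow_insert sum.union_disjoint sum.reindex add.commute)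
qed

lemma sampled_insert:
  assumes "finite A" "a \<notin> A"
  shows "sampled p (insert a A) h = p * sampled p A (\<lambda>B. h (insert a B)) + (1 - p) * sampled p A h"
proof -
  have "finite B \<and> a \<notin> B \<and> card B \<le> card A" if "B \<in> Pow A" for B
    using that assms by (auto intro: finite_subset card_mono)
  then show ?thesis
    using assms unfolding sampled_def
    by (subst sum_Pow_insert)
       (auto simp: sum_distrib_left Suc_diff_le mult_ac intro!: arg_cong2[where f = "(+)"] sum.cong)
qed

lemma sampled_mono:
  assumes "0 \<le> p" "p \<le> 1" "\<And>B. B \<subseteq> A \<Longrightarrow> h B \<le> h' B"
  shows "sampled p A h \<le> sampled p A h'"
  unfolding sampled_def using assms by (intro sum_mono mult_left_mono) auto

lemma sampled_linear:
  "sampled p A (\<lambda>X. a * g X + b * h X) = a * sampled p A g + b * sampled p A h"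
  unfolding sampled_def sum_distrib_left sum.distrib[symmetric]
  by (intro sum.cong refl) (simp add: algebra_simps)

lemma sampled_Un:
  assumes "finite A" "finite C" "A \<inter> C = {}"
  shows "sampled p (A \<union> C) h = sampled p A (\<lambda>X. sampled p C (\<lambda>Y. h (X \<union> Y)))"
  using assms
proof (induction A arbitrary: h rule: finite_induct)
  case (insert a A)
  then show ?case
    by (simp add: sampled_insert)
qed simp

lemma submodular_onD:
  "submodular_on N u \<Longrightarrow> A \<subseteq> N \<Longrightarrow> B \<subseteq> N \<Longrightarrow> u (A \<union> B) + u (A \<inter> B) \<le> u A + u B"
  by (simp add: submodular_on_def)

text \<open>Among all random subsets of \<open>A\<close> with marginals \<open>p\<close>, keeping
  everything or nothing is the worst for a submodular function; independent choice does at least as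
  well.\<close>

lemma sampled_submodular_ge:
  assumes "submodular_on N h" "finite A" "A \<subseteq> N" "T \<subseteq> N" "A \<inter> T = {}" "0 \<le> p" "p \<le> 1"
  shows "(1 - p) * h T + p * h (T \<union> A) \<le> sampled p A (\<lambda>X. h (T \<union> X))"
  using assms(2-5)
proof (induction A arbitrary: T rule: finite_induct)
  case (insert a A)
  have *: "h (insert a (T \<union> A)) + h T \<le> h (insert a T) + h (T \<union> A)"
    using submodular_onD[OF assms(1), of "insert a T" "T \<union> A"] insert.hyps insert.prems
    by (simp add: Int_absorb2)
  have 1: "(1 - p) * h (insert a T) + p * h (insert a (T \<union> A)) \<le> sampled p A (\<lambda>X. h (insert a (T \<union> X)))"
    using insert.IH[of "insert a T"] insert.hyps insert.prems by (auto)
  have 2: "(1 - p) * h T + p * h (T \<union> A) \<le> sampled p A (\<lambda>X. h (T \<union> X))"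
    using insert.IH[of T] insert.hyps insert.prems by auto
  \<comment> \<open>Drawing \<open>a\<close> independently of the rest instead of together with it
    gains \<open>p * (1 - p)\<close> times the defect in \<open>*\<close>, which is non-negative by
    submodularity.\<close>
  have "(1 - p) * h T + p * h (insert a (T \<union> A)) =
      p * ((1 - p) * h (insert a T) + p * h (insert a (T \<union> A))) + (1 - p) * ((1 - p) * h T + p * h (T \<union> A))
      - p * (1 - p) * (h (insert a T) + h (T \<union> A) - h (insert a (T \<union> A)) - h T)"
    by algebra
  also have "\<dots> \<le> p * ((1 - p) * h (insert a T) + p * h (insert a (T \<union> A))) + (1 - p) * ((1 - p) * h T + p * h (T \<union> A))"
    using * assms(6,7) by simp
  also have "\<dots> \<le> p * sampled p A (\<lambda>X. h (insert a (T \<union> X))) + (1 - p) * sampled p A (\<lambda>X. h (T \<union> X))"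
    using 1 2 assms(6,7) by (intro add_mono mult_left_mono) auto
  finally show ?case
    using insert.hyps by (simp add: sampled_insert)
qed (simp add: algebra_simps)

text \<open>Blocks are dissolved one at a time: given the fate of block \<open>a\<close>, the
  induction hypothesis dissolves the other blocks, and then \<open>sampled_submodular_ge\<close>
  dissolves \<open>a\<close>. \<open>T\<close> carries what has already been chosen.\<close>

lemma sampled_blocks_le:
  assumes "submodular_on N h" "finite N" "0 \<le> p" "p \<le> 1"
    and "finite I" "disjoint_family_on S I" "(\<Union>i\<in>I. S i) \<subseteq> N" "T \<subseteq> N" "(\<Union>i\<in>I. S i) \<inter> T = {}"
  shows "sampled p I (\<lambda>J. h (T \<union> (\<Union>i\<in>J. S i))) \<le> sampled p (\<Union>i\<in>I. S i) (\<lambda>X. h (T \<union> X))"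
  using assms(5-9)
proof (induction I arbitrary: T rule: finite_induct)
  case (insert a I)
  let ?V = "\<Union>i\<in>I. S i"
  have fin: "finite (S a)" "finite ?V"
    using insert.prems assms(2) by (auto intro: finite_subset)
  have dj: "S a \<inter> ?V = {}"
    using insert.hyps insert.prems by (auto simp: disjoint_family_on_def)
  have dI: "disjoint_family_on S I"
    using insert.prems by (auto simp: disjoint_family_on_def)
  have "sampled p (insert a I) (\<lambda>J. h (T \<union> (\<Union>i\<in>J. S i))) =
      p * sampled p I (\<lambda>J. h ((T \<union> S a) \<union> (\<Union>i\<in>J. S i))) + (1 - p) * sampled p I (\<lambda>J. h (T \<union> (\<Union>i\<in>J. S i)))"
    using insert.hyps by (simp add: sampled_insert Un_assoc)
  also have "\<dots> \<le> p * sampled p ?V (\<lambda>X. h ((T \<union> S a) \<union> X)) + (1 - p) * sampled p ?V (\<lambda>X. h (T \<union> X))"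
    using insert.IH[of "T \<union> S a"] insert.IH[of T] insert.prems dI dj assms(3,4)
    by (intro add_mono mult_left_mono) auto
  also have "\<dots> = sampled p ?V (\<lambda>X. p * h ((T \<union> X) \<union> S a) + (1 - p) * h (T \<union> X))"
    by (simp add: sampled_linear Un_ac)
  also have "\<dots> \<le> sampled p ?V (\<lambda>X. sampled p (S a) (\<lambda>Y. h ((T \<union> X) \<union> Y)))"
  proof (rule sampled_mono)
    fix X assume "X \<subseteq> ?V"
    then have "S a \<subseteq> N" "T \<union> X \<subseteq> N" "S a \<inter> (T \<union> X) = {}"
      using insert.prems dj by blast+
    from sampled_submodular_ge[OF assms(1) fin(1) this assms(3,4)]
    show "p * h ((T \<union> X) \<union> S a) + (1 - p) * h (T \<union> X) \<le> sampled p (S a) (\<lambda>Y. h ((T \<union> X) \<union> Y))"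
      by (simp only: add.commute)
  qed (use assms in auto)
  also have "\<dots> = sampled p (?V \<union> S a) (\<lambda>X. h (T \<union> X))"
    using fin dj by (simp add: sampled_Un Un_assoc Int_commute)
  finally show ?case
    by (simp add: Un_commute)
qed simp

section \<open>Sums of a submodular function over all sets of one size\<close>

lemma sum_level_insert:
  fixes g :: "'a set \<Rightarrow> real"
  assumes "finite M" "a \<notin> M"
  shows "(\<Sum>B | B \<subseteq> insert a M \<and> card B = Suc j. g B) =
    (\<Sum>B | B \<subseteq> M \<and> card B = j. g (insert a B)) + (\<Sum>B | B \<subseteq> M \<and> card B = Suc j. g B)"
proof -
  have eq: "{B. B \<subseteq> X \<and> card B = i} = {B \<in> Pow X. card B = i}" for X :: "'a set" and i
    by auto
  have *: "card (insert a B) = Suc (card B)" if "B \<in> Pow M" for B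
    using that assms by (auto intro!: card_insert_disjoint intro: finite_subset)
  have "(\<Sum>B | B \<subseteq> insert a M \<and> card B = Suc j. g B) = (\<Sum>B\<in>Pow (insert a M). if card B = Suc j then g B else 0)"
    unfolding eq using assms by (subst sum.inter_filter) auto
  also have "\<dots> = (\<Sum>B\<in>Pow M. if card B = j then g (insert a B) else 0) + (\<Sum>B\<in>Pow M. if card B = Suc j then g B else 0)"
    using assms * by (subst sum_Pow_insert) (auto intro!: sum.cong)
  also have "\<dots> = (\<Sum>B | B \<subseteq> M \<and> card B = j. g (insert a B)) + (\<Sum>B | B \<subseteq> M \<and> card B = Suc j. g B)"
    unfolding eq using assms by (intro arg_cong2[where f = "(+)"] sum.inter_filter[symmetric]) simp_all
  finally show ?thesis .
qed

lemma submodular_on_insert: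
  assumes "submodular_on (insert a M) g"
  shows "submodular_on M (\<lambda>B. g (insert a B))"
  unfolding submodular_on_def
proof (intro allI impI)
  fix A B assume "A \<subseteq> M" "B \<subseteq> M"
  moreover have "insert a A \<union> insert a B = insert a (A \<union> B)" "insert a A \<inter> insert a B = insert a (A \<inter> B)"
    by auto
  ultimately show "g (insert a (A \<union> B)) + g (insert a (A \<inter> B)) \<le> g (insert a A) + g (insert a B)"
    using submodular_onD[OF assms, of "insert a A" "insert a B"] by (simp add: subset_insertI2)
qed

lemma submodular_on_subset: "submodular_on N g \<Longrightarrow> M \<subseteq> N \<Longrightarrow> submodular_on M g"
  by (auto simp: submodular_on_def)

lemma level_0 [simp]: "finite M \<Longrightarrow> {B. B \<subseteq> M \<and> card B = 0} = {{}}"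
  by (auto dest: finite_subset)

text \<open>In terms of averages: the mean of \<open>g\<close> over the sets of a given size lies
  above the chord from \<open>g {}\<close> to \<open>g M\<close>, since expected marginals decrease
  along a random order of \<open>M\<close>. The induction splits the sets by membership of the new
  element \<open>a\<close>.\<close>

lemma level_sum_submodular_ge:
  assumes "finite M" "M \<noteq> {}" "submodular_on M g"
  shows "real ((card M - 1) choose Suc j) * g {} + real ((card M - 1) choose j) * g M
    \<le> (\<Sum>B | B \<subseteq> M \<and> card B = Suc j. g B)"
  using assms
proof (induction M arbitrary: g j rule: finite_ne_induct)
  case (singleton x)
  have eq: "{B. B \<subseteq> {x} \<and> card B = Suc j} = (if j = 0 then {{x}} else {})"
    by (auto simp: subset_singleton_iff)
  show ?case
    unfolding eq by (cases j) simp_all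
next
  case (insert a M)
  obtain m where m: "card M = Suc m"
    using insert.hyps by (metis card_eq_0_iff not0_implies_Suc)
  note sub = submodular_on_subset[OF insert.prems subset_insertI]
  have le: "g (insert a M) + g {} \<le> g {a} + g M"
    using submodular_onD[OF insert.prems, of "{a}" M] insert.hyps by auto
  have IH1: "real (m choose Suc j) * g {} + real (m choose j) * g M \<le> (\<Sum>B | B \<subseteq> M \<and> card B = Suc j. g B)"
    using insert.IH[OF sub, of j] m by simp
  \<comment> \<open>The difference of binomials is \<open>m choose (j - 1)\<close> for positive
    \<open>j\<close> and zero for \<open>j = 0\<close>, so this form covers both cases.\<close>
  have IH2: "real (m choose j) * g {a} + (real (Suc m choose j) - real (m choose j)) * g (insert a M)
      \<le> (\<Sum>B | B \<subseteq> M \<and> card B = j. g (insert a B))"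
  proof (cases j)
    case (Suc i)
    then show ?thesis
      using insert.IH[OF submodular_on_insert[OF insert.prems], of i] m by simp
  qed (use insert.hyps in simp)
  have "real (Suc m choose Suc j) * g {} + real (Suc m choose j) * g (insert a M) =
    real (m choose Suc j) * g {} + real (m choose j) * (g {} + g (insert a M))
    + (real (Suc m choose j) - real (m choose j)) * g (insert a M)"
    by (simp add: algebra_simps)
  also have "\<dots> \<le> real (m choose Suc j) * g {} + real (m choose j) * (g {a} + g M)
    + (real (Suc m choose j) - real (m choose j)) * g (insert a M)"
    using mult_left_mono[OF le, of "real (m choose j)"] by (simp add: algebra_simps)
  also have "\<dots> \<le> (\<Sum>B | B \<subseteq> insert a M \<and> card B = Suc j. g B)"
    using IH1 IH2 insert.hyps by (simp add: sum_level_insert algebra_simps)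
  finally show ?case
    using insert.hyps m by simp
qed

text \<open>Counting pairs of a set and a member reduces a level to the sets through one fixed
  \<open>i\<close>. There \<open>{i}\<close> is the bottom set, so
  \<open>level_sum_submodular_ge\<close> yields \<open>g {i}\<close> where it would otherwise yield
  the value of the empty set.\<close>

lemma level_sum_double_count:
  fixes g :: "'a set \<Rightarrow> real"
  assumes "finite I"
  shows "real (Suc j) * (\<Sum>J | J \<subseteq> I \<and> card J = Suc j. g J) =
    (\<Sum>i\<in>I. \<Sum>B | B \<subseteq> I - {i} \<and> card B = j. g (insert i B))"
proof -
  have fin: "finite {J. J \<subseteq> I \<and> card J = Suc j}"
    using assms by simp
  have "real (Suc j) * (\<Sum>J | J \<subseteq> I \<and> card J = Suc j. g J) =
      (\<Sum>J | J \<subseteq> I \<and> card J = Suc j. \<Sum>i | i \<in> I \<and> i \<in> J. g J)"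
  proof -
    have "{i. i \<in> I \<and> i \<in> J} = J" if "J \<subseteq> I" for J
      using that by auto
    then show ?thesis
      by (simp add: sum_distrib_left)
  qed
  also have "\<dots> = (\<Sum>i\<in>I. \<Sum>J | J \<in> {J. J \<subseteq> I \<and> card J = Suc j} \<and> i \<in> J. g J)"
    by (rule sum.swap_restrict[OF fin assms])
  also have "\<dots> = (\<Sum>i\<in>I. \<Sum>B | B \<subseteq> I - {i} \<and> card B = j. g (insert i B))"
  proof (rule sum.cong[OF refl])
    fix i assume "i \<in> I"
    have *: "finite B" if "B \<subseteq> I" for B
      using that assms by (rule finite_subset)
    show "(\<Sum>J | J \<in> {J. J \<subseteq> I \<and> card J = Suc j} \<and> i \<in> J. g J) = (\<Sum>B | B \<subseteq> I - {i} \<and> card B = j. g (insert i B))"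
      by (rule sum.reindex_bij_witness[where i = "insert i" and j = "\<lambda>J. J - {i}"])
         (use \<open>i \<in> I\<close> * in \<open>auto simp: insert_absorb card_insert_if subset_Diff_insert\<close>)
  qed
  finally show ?thesis .
qed

lemma sampled_eq_level_sums:
  assumes "finite I"
  shows "sampled p I h = (\<Sum>j\<le>card I. p ^ j * (1 - p) ^ (card I - j) * (\<Sum>J | J \<subseteq> I \<and> card J = j. h J))"
proof -
  have "(\<Sum>j\<le>card I. \<Sum>J\<in>{J \<in> Pow I. card J = j}. p ^ card J * (1 - p) ^ (card I - card J) * h J) = sampled p I h"
    unfolding sampled_def using assms by (intro sum.group) (auto intro: card_mono)
  then show ?thesis
    by (auto simp: sum_distrib_left intro!: sum.cong)
qed

text \<open>On the families through \<open>i\<close> the bottom value is \<open>h {i}\<close>, and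
  only these values are kept; those of the empty and of the full family are discarded by
  non-negativity.\<close>

lemma sampled_ge_singletons:
  assumes "utility_on I h" "finite I" "card I = Suc (Suc m)" "0 \<le> p" "p \<le> 1"
  shows "(1 - p) / real (Suc m) * (1 - (1 - p) ^ Suc m) * (\<Sum>i\<in>I. h {i}) \<le> sampled p I h"
proof -
  define T where "T j = (\<Sum>J | J \<subseteq> I \<and> card J = j. h J)" for j
  define \<sigma> where "\<sigma> = (\<Sum>i\<in>I. h {i})"
  have nn: "h J \<ge> 0" if "J \<subseteq> I" for J
    using assms(1) that by (auto simp: utility_on_def)
  have sub: "submodular_on I h"
    using assms(1) by (auto simp: utility_on_def)
  have T0: "T j \<ge> 0" for j
    unfolding T_def by (rule sum_nonneg) (use nn in auto)
  have level: "real (m choose j) * h {i} \<le> (\<Sum>B | B \<subseteq> I - {i} \<and> card B = j. h (insert i B))" if "i \<in> I" for i j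
  proof -
    have "submodular_on (I - {i}) (\<lambda>B. h (insert i B))"
      using sub that by (intro submodular_on_insert) (simp add: insert_absorb)
    moreover have "card (I - {i}) = Suc m"
      using that assms by simp
    moreover have "h (insert i (I - {i})) \<ge> 0"
      using that by (intro nn) auto
    moreover have "I - {i} \<noteq> {}"
      using \<open>card (I - {i}) = Suc m\<close> by force
    ultimately have *: "real (m choose Suc j') * h {i} + real (m choose j') * h (insert i (I - {i}))
        \<le> (\<Sum>B | B \<subseteq> I - {i} \<and> card B = Suc j'. h (insert i B))"
      and "0 \<le> real (m choose j') * h (insert i (I - {i}))" for j'
      using level_sum_submodular_ge[of "I - {i}" "\<lambda>B. h (insert i B)" j'] assms(2) by auto
    then have "real (m choose Suc j') * h {i} \<le> (\<Sum>B | B \<subseteq> I - {i} \<and> card B = Suc j'. h (insert i B))" for j'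
      by (meson add_increasing2 order_trans order_refl)
    then show ?thesis
      using assms(2) by (cases j) (simp_all del: binomial_Suc_Suc)
  qed
  have T_ge: "real (Suc m choose Suc j) / real (Suc m) * \<sigma> \<le> T (Suc j)" for j
  proof -
    have "real (m choose j) * \<sigma> \<le> real (Suc j) * T (Suc j)"
      unfolding T_def level_sum_double_count[OF assms(2)] unfolding \<sigma>_def sum_distrib_left
      by (intro sum_mono level)
    then have "real (m choose j) / real (Suc j) * \<sigma> \<le> T (Suc j)"
      by (simp add: pos_divide_le_eq mult.commute del: of_nat_Suc)
    moreover have "real (Suc m) * real (m choose j) = real (Suc m choose Suc j) * real (Suc j)"
      by (simp only: Suc_times_binomial_eq flip: of_nat_mult)
    then have "real (Suc m choose Suc j) / real (Suc m) = real (m choose j) / real (Suc j)"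
      by (simp add: frac_eq_eq mult.commute del: of_nat_Suc binomial_Suc_Suc)
    ultimately show ?thesis
      by (simp only:)
  qed
  \<comment> \<open>The expansion has one trial fewer than there are blocks, because a factor
    \<open>1 - p\<close> is split off from every term below. Removing the case of zero successes
    leaves \<open>1 - (1 - p) ^ Suc m\<close>.\<close>
  have "1 = (p + (1 - p)) ^ Suc m" by simp
  also have "\<dots> = (\<Sum>j\<le>Suc m. real (Suc m choose j) * p ^ j * (1 - p) ^ (Suc m - j))"
    by (rule binomial_ring)
  also have "\<dots> = (1 - p) ^ Suc m + (\<Sum>j\<le>m. real (Suc m choose Suc j) * p ^ Suc j * (1 - p) ^ (m - j))"
    by (subst sum.atMost_Suc_shift) simp
  finally have bin: "1 - (1 - p) ^ Suc m = (\<Sum>j\<le>m. real (Suc m choose Suc j) * p ^ Suc j * (1 - p) ^ (m - j))"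
    by simp
  have "(1 - p) / real (Suc m) * (1 - (1 - p) ^ Suc m) * \<sigma> =
      (\<Sum>j\<le>m. p ^ Suc j * (1 - p) ^ (Suc m - j) * (real (Suc m choose Suc j) / real (Suc m) * \<sigma>))"
    unfolding bin sum_distrib_left sum_distrib_right
    by (intro sum.cong) (auto simp: Suc_diff_le)
  also have "\<dots> \<le> (\<Sum>j\<le>m. p ^ Suc j * (1 - p) ^ (Suc m - j) * T (Suc j))"
    using assms by (intro sum_mono mult_left_mono T_ge) auto
  also have "\<dots> \<le> (1 - p) ^ Suc (Suc m) * T 0 + (\<Sum>j\<le>Suc m. p ^ Suc j * (1 - p) ^ (Suc m - j) * T (Suc j))"
    using assms T0 by (simp)
  also have "\<dots> = (\<Sum>j\<le>Suc (Suc m). p ^ j * (1 - p) ^ (Suc (Suc m) - j) * T j)"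
    by (subst (2) sum.atMost_Suc_shift) simp
  also have "\<dots> = sampled p I h"
    using assms by (simp add: sampled_eq_level_sums T_def)
  finally show ?thesis
    unfolding \<sigma>_def .
qed

section \<open>The machine program and the law of its output\<close>

lemma run_simps [simp]:
  "run orc (Output S) = return_spmf (S, 0, 0)"
  "run orc (Query Q c) = map_spmf (\<lambda>(S, q, t). (S, Suc q, Suc t)) (run orc (c (orc Q)))"
  "run orc (Random p) = map_spmf (\<lambda>(S, q, t). (S, q, Suc t)) (bind_spmf (spmf_of_pmf p) (run orc))"
  "run orc (Internal b) = map_spmf (\<lambda>(S, q, t). (S, q, Suc t)) (run orc b)"
  by (subst run.simps; simp)+

text \<open>Register 1 holds \<open>k\<close>, register 2 the current item, register 3 the drawn
  player and register 4 the constant 1. Register 5 is never written and stays 0, so the last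
  instruction is an unconditional jump.\<close>

definition random_allocation_program :: "nat \<Rightarrow> instr list" where
  "random_allocation_program k =
    [Const 1 k, Const 4 1, JumpLess 2 0 4, Halt, Uniform 3 1, Store 2 3, Add 2 2 4, JumpLess 5 4 2]"

lemma exec_simps:
  "step n (fetch P s) s = Stop S \<Longrightarrow> exec P n s = Output S"
  "step n (fetch P s) s = Draw p \<Longrightarrow> exec P n s = Random (map_pmf (exec P n) p)"
  "step n (fetch P s) s = Go s' \<Longrightarrow> exec P n s = Internal (exec P n s')"
  by (subst exec.code; simp)+

text \<open>Loop invariant: items below \<open>x\<close> are settled in memory, the others are still
  independent and uniform. Every item costs five instructions and the final failing test costs one;
  halting is free.\<close>

lemma run_random_allocation_loop:
  assumes "pc s = 2" "reg s 0 = n" "reg s 1 = k" "reg s 2 = x" "reg s 4 = 1" "reg s 5 = 0" "x \<le> n"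
  shows "run orc (exec (random_allocation_program k) n s) =
    spmf_of_pmf (map_pmf (\<lambda>g. (\<lambda>p. {y. y < n \<and> (if y < x then mem s y else g y) = p}, 0, 5 * (n - x) + 1))
      (Pi_pmf {x..<n} 0 (\<lambda>_. pmf_of_set {0..k - 1})))"
  using assms
proof (induction "n - x" arbitrary: s x)
  case 0
  let ?P = "random_allocation_program k"
  let ?s = "s\<lparr>pc := 3\<rparr>"
  have 1: "exec ?P n s = Internal (exec ?P n ?s)"
    using 0 by (intro exec_simps) (simp add: fetch_def random_allocation_program_def)
  have 2: "exec ?P n ?s = Output (\<lambda>p. {x. x < n \<and> mem s x = p})"
    using 0 by (intro exec_simps) (simp add: fetch_def random_allocation_program_def)
  have [simp]: "x = n"
    using 0 by simp
  have eq: "{y. y < n \<and> (if y < n then mem s y else 0) = p} = {x. x < n \<and> mem s x = p}" for p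
    by auto
  show ?case
    by (simp add: 1 2 eq)
next
  case (Suc d)
  let ?P = "random_allocation_program k"
  let ?s1 = "s\<lparr>pc := 4\<rparr>"
  let ?s2 = "\<lambda>r. s\<lparr>reg := (reg s)(3 := r), pc := 5\<rparr>"
  let ?s3 = "\<lambda>r. s\<lparr>pc := 6, reg := (reg s)(3 := r), mem := (mem s)(x := r)\<rparr>"
  let ?s4 = "\<lambda>r. s\<lparr>pc := 7, reg := (reg s)(3 := r, 2 := Suc x), mem := (mem s)(x := r)\<rparr>"
  let ?s5 = "\<lambda>r. s\<lparr>pc := 2, reg := (reg s)(3 := r, 2 := Suc x), mem := (mem s)(x := r)\<rparr>"
  have x: "x < n"
    using Suc by simp
  have 1: "exec ?P n s = Internal (exec ?P n ?s1)"
    using Suc.prems x by (intro exec_simps) (simp add: fetch_def random_allocation_program_def)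
  have 2: "exec ?P n ?s1 = Random (map_pmf (exec ?P n) (map_pmf ?s2 (pmf_of_set {0..k - 1})))"
    using Suc.prems x by (intro exec_simps) (simp add: fetch_def random_allocation_program_def set_reg_def[abs_def])
  have 3: "exec ?P n (?s2 r) = Internal (exec ?P n (?s3 r))" for r
    using Suc.prems x by (intro exec_simps) (simp add: fetch_def random_allocation_program_def)
  have 4: "exec ?P n (?s3 r) = Internal (exec ?P n (?s4 r))" for r
    using Suc.prems x by (intro exec_simps) (simp add: fetch_def random_allocation_program_def set_reg_def)
  have 5: "exec ?P n (?s4 r) = Internal (exec ?P n (?s5 r))" for r
    using Suc.prems x by (intro exec_simps) (simp add: fetch_def random_allocation_program_def)
  have IH: "run orc (exec ?P n (?s5 r)) = spmf_of_pmf (map_pmf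
      (\<lambda>g. (\<lambda>p. {y. y < n \<and> (if y < Suc x then ((mem s)(x := r)) y else g y) = p}, 0, 5 * (n - Suc x) + 1))
      (Pi_pmf {Suc x..<n} 0 (\<lambda>_. pmf_of_set {0..k - 1})))" for r
    by (subst Suc.hyps(1)[of "Suc x"]) (use Suc x in auto)
  have ins: "{x..<n} = insert x {Suc x..<n}"
    using x by auto
  have t: "5 * (n - x) + 1 = Suc (Suc (Suc (Suc (Suc (5 * (n - Suc x) + 1)))))"
    using x by (simp add: Suc_diff_Suc)
  have eq: "{y. y < n \<and> (if y < Suc x then ((mem s)(x := r)) y else g y) = p} =
      {y. y < n \<and> (if y < x then mem s y else (g(x := r)) y) = p}" for g r p
    by (auto simp: less_Suc_eq)
  show ?case
    unfolding 1 ins t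
    by (simp add: 2 3 4 5 IH eq Pi_pmf_insert' spmf_of_pmf_bind bind_map_pmf map_bind_pmf pmf.map_comp o_def
       map_spmf_conv_bind_spmf bind_assoc_pmf bind_return_pmf)
qed

lemma run_random_allocation:
  "run orc (program_alg (random_allocation_program k) n) =
    spmf_of_pmf (map_pmf (\<lambda>g. (\<lambda>p. {y \<in> {..<n}. g y = p}, 0, 5 * n + 3))
      (Pi_pmf {..<n} 0 (\<lambda>_. pmf_of_set {0..k - 1})))"
proof -
  let ?P = "random_allocation_program k"
  let ?s = "initial_state n"
  let ?s1 = "?s\<lparr>reg := (reg ?s)(1 := k), pc := 1\<rparr>"
  let ?s2 = "?s\<lparr>reg := (reg ?s)(1 := k, 4 := 1), pc := 2\<rparr>"
  have 1: "exec ?P n ?s = Internal (exec ?P n ?s1)"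
    by (intro exec_simps) (simp add: fetch_def random_allocation_program_def set_reg_def initial_state_def)
  have 2: "exec ?P n ?s1 = Internal (exec ?P n ?s2)"
    by (intro exec_simps) (simp add: fetch_def random_allocation_program_def set_reg_def initial_state_def)
  show ?thesis
    unfolding program_alg_def 1 2 run_simps
    by (subst run_random_allocation_loop[where x = 0])
       (auto simp: initial_state_def pmf.map_comp o_def atLeast0LessThan numeral_3_eq_3)
qed

section \<open>Expected welfare compared with the optimum\<close>

lemma expectation_uniform_class:
  assumes "finite A" "p < k"
  shows "measure_pmf.expectation (Pi_pmf A 0 (\<lambda>_. pmf_of_set {0..k - 1})) (\<lambda>g. h {y \<in> A. g y = p}) =
    sampled (1 / real k) A h"
  using assms(1)
proof (induction A arbitrary: h rule: finite_induct)
  case (insert x A)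
  let ?q = "\<lambda>A. Pi_pmf A 0 (\<lambda>_. pmf_of_set {0..k - 1})"
  let ?E = "\<lambda>h. measure_pmf.expectation (?q A) (\<lambda>g. h {y \<in> A. g y = p})"
  have fin: "finite (set_pmf (?q A))"
    using insert.hyps by (intro finite_subset[OF set_Pi_pmf_subset']) auto
  have eq: "{y \<in> insert x A. (g(x := a)) y = p} = (if a = p then insert x {y \<in> A. g y = p} else {y \<in> A. g y = p})"
    for g :: "'a \<Rightarrow> nat" and a
    using insert.hyps by auto
  have "measure_pmf.expectation (?q (insert x A)) (\<lambda>g. h {y \<in> insert x A. g y = p}) =
    (\<Sum>a\<in>{0..k - 1}. 1 / real k * measure_pmf.expectation (map_pmf (\<lambda>g. g(x := a)) (?q A)) (\<lambda>g. h {y \<in> insert x A. g y = p}))"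
    using insert.hyps assms(2) fin
    by (subst Pi_pmf_insert') (auto simp: map_pmf_def[symmetric] pmf_expectation_bind[where A = "{0..k - 1}"])
  also have "\<dots> = (\<Sum>a\<in>{0..k - 1}. 1 / real k * (if a = p then ?E (\<lambda>B. h (insert x B)) else ?E h))"
    by (intro sum.cong refl) (simp only: integral_map_pmf eq if_distrib[of "h"] split: if_split, simp)
  also have "\<dots> = 1 / real k * ?E (\<lambda>B. h (insert x B)) + (\<Sum>a\<in>{0..k - 1} - {p}. 1 / real k * ?E h)"
    using assms(2) by (subst sum.remove[of _ p]) auto
  also have "\<dots> = 1 / real k * ?E (\<lambda>B. h (insert x B)) + (1 - 1 / real k) * ?E h"
    using assms(2) by (simp add: field_simps)
  also have "\<dots> = sampled (1 / real k) (insert x A) h"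
    by (simp only: insert.IH[of h] insert.IH[of "\<lambda>B. h (insert x B)"] sampled_insert[OF insert.hyps])
  finally show ?case .
qed simp

text \<open>Allocations are unconstrained outside \<open>{..<k}\<close>, so there are infinitely
  many. Their welfare depends only on the restriction to \<open>{..<k}\<close>, which makes the
  \<open>Max\<close> in \<open>opt_welfare\<close> meaningful.\<close>

lemma finite_welfare_image:
  assumes "finite N"
  shows "finite (welfare k u ` {S. allocation k N S})"
proof (rule finite_subset)
  show "welfare k u ` {S. allocation k N S} \<subseteq> welfare k u ` ({..<k} \<rightarrow>\<^sub>E Pow N)"
  proof
    fix w assume "w \<in> welfare k u ` {S. allocation k N S}"
    then obtain S where S: "allocation k N S" "w = welfare k u S"
      by auto
    then have "restrict S {..<k} \<in> {..<k} \<rightarrow>\<^sub>E Pow N" "w = welfare k u (restrict S {..<k})"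
      by (auto simp: allocation_def welfare_def)
    then show "w \<in> welfare k u ` ({..<k} \<rightarrow>\<^sub>E Pow N)"
      by blast
  qed
qed (use assms in \<open>auto intro!: finite_PiE\<close>)

lemma welfare_le_opt: "finite N \<Longrightarrow> allocation k N S \<Longrightarrow> welfare k u S \<le> opt_welfare k N u"
  unfolding opt_welfare_def by (intro Max_ge finite_welfare_image) auto

lemma opt_welfare_attained:
  assumes "finite N" "k > 0"
  obtains S where "allocation k N S" "welfare k u S = opt_welfare k N u"
proof -
  have "allocation k N (\<lambda>i. if i = 0 then N else {})"
    using assms by (auto simp: allocation_def disjoint_family_on_def split: if_splits)
  then have "opt_welfare k N u \<in> welfare k u ` {S. allocation k N S}"
    unfolding opt_welfare_def using assms by (intro Max_in finite_welfare_image) auto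
  then show thesis
    using that by auto
qed

text \<open>Disjointness makes the union of blocks commute with intersections of families, not only
  with unions, so submodularity is inherited.\<close>

lemma submodular_on_blocks:
  assumes "submodular_on N f" "disjoint_family_on S I" "(\<Union>i\<in>I. S i) \<subseteq> N"
  shows "submodular_on I (\<lambda>J. f (\<Union>i\<in>J. S i))"
  unfolding submodular_on_def
proof (intro allI impI)
  fix A B assume AB: "A \<subseteq> I" "B \<subseteq> I"
  have "(\<Union>i\<in>A. S i) \<inter> (\<Union>i\<in>B. S i) \<subseteq> (\<Union>i\<in>A \<inter> B. S i)"
  proof
    fix x assume "x \<in> (\<Union>i\<in>A. S i) \<inter> (\<Union>i\<in>B. S i)"
    then obtain i j where ij: "i \<in> A" "j \<in> B" "x \<in> S i" "x \<in> S j"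
      by auto
    then have "i = j"
      using assms(2) AB by (auto simp: disjoint_family_on_def)
    with ij show "x \<in> (\<Union>i\<in>A \<inter> B. S i)"
      by auto
  qed
  then have int: "(\<Union>i\<in>A. S i) \<inter> (\<Union>i\<in>B. S i) = (\<Union>i\<in>A \<inter> B. S i)"
    by auto
  have "(\<Union>i\<in>A. S i) \<subseteq> N" "(\<Union>i\<in>B. S i) \<subseteq> N"
    using AB assms(3) by blast+
  then show "f (\<Union>i\<in>A \<union> B. S i) + f (\<Union>i\<in>A \<inter> B. S i) \<le> f (\<Union>i\<in>A. S i) + f (\<Union>i\<in>B. S i)"
    using submodular_onD[OF assms(1), of "\<Union>i\<in>A. S i" "\<Union>i\<in>B. S i"] int by simp
qed

lemma sampled_ge_opt:
  assumes "2 \<le> k" "utility_on N f" "finite N"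
  shows "(1 - (1 - 1 / real k) ^ (k - 1)) * opt_welfare k N (\<lambda>_. f) \<le> real k * sampled (1 / real k) N f"
proof -
  obtain S where S: "allocation k N S" "welfare k (\<lambda>_. f) S = opt_welfare k N (\<lambda>_. f)"
    using opt_welfare_attained[of N k] assms by auto
  obtain m where m: "k = Suc (Suc m)"
    using assms(1) by (metis add_2_eq_Suc le_Suc_ex)
  have un: "(\<Union>i<k. S i) = N" and dj: "disjoint_family_on S {..<k}"
    using S by (auto simp: allocation_def)
  have sub: "submodular_on N f"
    using assms(2) by (auto simp: utility_on_def)
  have "f (\<Union>i\<in>J. S i) \<ge> 0" if "J \<subseteq> {..<k}" for J
  proof -
    have "(\<Union>i\<in>J. S i) \<subseteq> N"
      using that un by blast
    then show ?thesis
      using assms(2) by (simp add: utility_on_def)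
  qed
  then have "utility_on {..<k} (\<lambda>J. f (\<Union>i\<in>J. S i))"
    using submodular_on_blocks[OF sub dj] un by (auto simp: utility_on_def)
  from sampled_ge_singletons[OF this, of m "1 / real k"]
  have "(1 - 1 / real k) / real (Suc m) * (1 - (1 - 1 / real k) ^ Suc m) * (\<Sum>i<k. f (S i))
      \<le> sampled (1 / real k) {..<k} (\<lambda>J. f (\<Union>i\<in>J. S i))"
    using m by simp
  \<comment> \<open>For sampling probability \<open>1 / k\<close> the factor cancels down to
    \<open>1 / k\<close>, which the sum over \<open>k\<close> players offsets exactly.\<close>
  also have "(1 - 1 / real k) / real (Suc m) = 1 / real k"
  proof -
    have "1 - 1 / real k = real (Suc m) / real k"
      using m by (simp add: field_simps)
    then show ?thesis
      by simp
  qed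
  also have "sampled (1 / real k) {..<k} (\<lambda>J. f (\<Union>i\<in>J. S i)) \<le> sampled (1 / real k) N f"
    using sampled_blocks_le[OF sub assms(3), of "1 / real k" "{..<k}" S "{}"] dj un assms(1) by simp
  finally have "1 / real k * (1 - (1 - 1 / real k) ^ (k - 1)) * opt_welfare k N (\<lambda>_. f) \<le> sampled (1 / real k) N f"
    using m S(2) by (simp add: welfare_def)
  from mult_left_mono[OF this, of "real k"] show ?thesis
    using assms(1) by simp
qed

lemma approximation_random_allocation:
  assumes "2 \<le> k"
  shows "approximation_algorithm k (1 - (1 - 1 / real k) ^ (k - 1)) (program_alg (random_allocation_program k))"
  unfolding approximation_algorithm_def
proof (intro allI impI conjI)
  fix n :: nat and f :: "nat set \<Rightarrow> real"
  assume f: "utility_on {..<n} f"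
  let ?q = "Pi_pmf {..<n} 0 (\<lambda>_. pmf_of_set {0..k - 1})"
  let ?S = "\<lambda>g p. {y \<in> {..<n}. g y = p}"
  let ?run = "run_on (program_alg (random_allocation_program k)) n f"
  have run: "?run = spmf_of_pmf (map_pmf (\<lambda>g. (?S g, 0, 5 * n + 3)) ?q)"
    by (simp add: run_on_def run_random_allocation)
  have set: "set_pmf ?q \<subseteq> PiE_dflt {..<n} 0 (\<lambda>_. {0..k - 1})"
    by (intro order_trans[OF set_Pi_pmf_subset']) auto
  show "lossless_spmf ?run"
    by (simp add: run)
  show "\<forall>(S, q, t)\<in>set_spmf ?run. allocation k {..<n} S"
  proof -
    have "allocation k {..<n} (?S g)" if "g \<in> set_pmf ?q" for g
      using that set assms by (fastforce simp: allocation_def disjoint_family_on_def PiE_dflt_def)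
    then show ?thesis
      by (auto simp: run)
  qed
  have fin: "finite (set_pmf ?q)"
    by (rule finite_subset[OF set]) auto
  have "(\<integral>(S, q, t). welfare k (\<lambda>_. f) S \<partial>measure_spmf ?run) =
      measure_pmf.expectation ?q (\<lambda>g. \<Sum>p<k. f (?S g p))"
    by (simp add: run welfare_def)
  also have "\<dots> = (\<Sum>p<k. measure_pmf.expectation ?q (\<lambda>g. f (?S g p)))"
    by (intro Bochner_Integration.integral_sum integrable_measure_pmf_finite fin)
  also have "\<dots> = (\<Sum>p<k. sampled (1 / real k) {..<n} f)"
    by (intro sum.cong refl expectation_uniform_class) auto
  finally show "(1 - (1 - 1 / real k) ^ (k - 1)) * opt_welfare k {..<n} (\<lambda>_. f)
      \<le> (\<integral>(S, q, t). welfare k (\<lambda>_. f) S \<partial>measure_spmf ?run)"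
    using sampled_ge_opt[OF assms f] by simp
qed

lemma linear_time_random_allocation: "linear_time (program_alg (random_allocation_program k))"
  unfolding linear_time_def by (intro exI[of _ 5]) (auto simp: run_on_def run_random_allocation)

section \<open>Transcripts of query algorithms\<close>

text \<open>\<open>run\<close> only counts queries, but the union bound over hidden partitions needs
  the queried sets themselves. Steps are not recorded.\<close>

partial_function (spmf) transcript ::
  "(nat set \<Rightarrow> real) \<Rightarrow> alg \<Rightarrow> ((nat \<Rightarrow> nat set) \<times> nat set list) spmf" where
  "transcript orc a = (case a of
      Output S \<Rightarrow> return_spmf (S, [])
    | Query Q c \<Rightarrow> map_spmf (apsnd ((#) Q)) (transcript orc (c (orc Q)))
    | Random p \<Rightarrow> bind_spmf (spmf_of_pmf p) (transcript orc)
    | Internal b \<Rightarrow> transcript orc b)"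

lemma transcript_simps [simp]:
  "transcript orc (Output S) = return_spmf (S, [])"
  "transcript orc (Query Q c) = map_spmf (apsnd ((#) Q)) (transcript orc (c (orc Q)))"
  "transcript orc (Random p) = bind_spmf (spmf_of_pmf p) (transcript orc)"
  "transcript orc (Internal b) = transcript orc b"
  by (subst transcript.simps; simp)+

lemma ord_spmf_map_mono:
  "ord_spmf (=) p q \<Longrightarrow> ord_spmf (=) (map_spmf f p) (map_spmf f q)"
  unfolding map_spmf_conv_bind_spmf by (intro bind_spmf_mono') (auto intro: ord_spmf_reflI)

lemma map_transcript_Query:
  "map_spmf (apsnd length) (map_spmf (apsnd ((#) Q)) p) = map_spmf (apsnd Suc) (map_spmf (apsnd length) p)"
  by (simp add: spmf.map_comp o_def apsnd_compose)

lemma map_run_step: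
  "map_spmf (\<lambda>(S, q, t). (S, q)) (map_spmf (\<lambda>(S, q, t). (S, Suc q, Suc t)) p) =
     map_spmf (apsnd Suc) (map_spmf (\<lambda>(S, q, t). (S, q)) p)"
  "map_spmf (\<lambda>(S, q, t). (S, q)) (map_spmf (\<lambda>(S, q, t). (S, q, Suc t)) p) = map_spmf (\<lambda>(S, q, t). (S, q)) p"
  by (simp_all add: spmf.map_comp o_def case_prod_beta' apsnd_def map_prod_def)

text \<open>Both laws are least fixed points. Each inequality is a fixed point induction on its
  left-hand side with the right-hand side unfolded once; antisymmetry then gives
  \<open>run_eq_transcript\<close>.\<close>

lemma run_transcript_le:
  "ord_spmf (=) (map_spmf (\<lambda>(S, q, t). (S, q)) (run orc a)) (map_spmf (apsnd length) (transcript orc a))"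
proof (induction arbitrary: orc a rule: run.fixp_induct)
  case 1
  show ?case by simp
next
  case 2
  show ?case by simp
next
  case (3 r)
  show ?case
  proof (cases a)
    case (Query Q c)
    then show ?thesis
      by (simp only: alg.case transcript_simps map_transcript_Query map_run_step) (intro ord_spmf_map_mono 3)
  next
    case (Random p)
    then show ?thesis
      by (simp only: alg.case transcript_simps map_run_step map_spmf_bind_spmf)
         (auto simp: o_def map_run_step intro!: bind_spmf_mono' 3 intro: ord_spmf_reflI simp del: bind_spmf_of_pmf)
  next
    case (Internal b)
    then show ?thesis
      by (simp only: alg.case transcript_simps map_run_step) (rule 3)
  qed simp
qed

lemma transcript_run_le:
  "ord_spmf (=) (map_spmf (apsnd length) (transcript orc a)) (map_spmf (\<lambda>(S, q, t). (S, q)) (run orc a))"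
proof (induction arbitrary: orc a rule: transcript.fixp_induct)
  case 1
  show ?case by simp
next
  case 2
  show ?case by simp
next
  case (3 r)
  show ?case
  proof (cases a)
    case (Query Q c)
    then show ?thesis
      by (simp only: alg.case run_simps map_transcript_Query map_run_step) (intro ord_spmf_map_mono 3)
  next
    case (Random p)
    then show ?thesis
      by (simp only: alg.case run_simps map_run_step map_spmf_bind_spmf)
         (auto simp: o_def map_run_step intro!: bind_spmf_mono' 3 intro: ord_spmf_reflI simp del: bind_spmf_of_pmf)
  next
    case (Internal b)
    then show ?thesis
      by (simp only: alg.case run_simps map_run_step) (rule 3)
  qed simp
qed

lemma run_eq_transcript:
  "map_spmf (\<lambda>(S, q, t). (S, q)) (run orc a) = map_spmf (apsnd length) (transcript orc a)"
  by (intro spmf.leq_antisym run_transcript_le transcript_run_le)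

section \<open>Comparing executions against two oracles\<close>

lemma nn_integral_lub_spmf:
  assumes chain: "Complete_Partial_Order.chain (ord_spmf (=)) Y" and Y: "Y \<noteq> {}"
  shows "(\<integral>\<^sup>+ x. g x \<partial>measure_spmf (lub_spmf Y)) = (SUP p\<in>Y. \<integral>\<^sup>+ x. g x \<partial>measure_spmf p)"
proof -
  let ?M = "count_space (set_spmf (lub_spmf Y))"
  have chain': "Complete_Partial_Order.chain (\<le>) ((\<lambda>p x. ennreal (spmf p x) * g x) ` Y)"
    using chain by (rule chain_imageI) (auto simp: le_fun_def dest: ord_spmf_eq_leD intro!: mult_right_mono)
  have "(\<integral>\<^sup>+ x. g x \<partial>measure_spmf (lub_spmf Y)) = (\<integral>\<^sup>+ x. (SUP p\<in>Y. ennreal (spmf p x) * g x) \<partial>?M)"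
    by (simp add: nn_integral_measure_spmf' ennreal_spmf_lub_spmf[OF chain Y] SUP_mult_right_ennreal Y)
  \<comment> \<open>The chain may be uncountable; monotone convergence still applies because the
    limit has countable support.\<close>
  also have "\<dots> = (SUP p\<in>Y. \<integral>\<^sup>+ x. ennreal (spmf p x) * g x \<partial>?M)"
    using Y chain' by (rule nn_integral_monotone_convergence_SUP_countable) simp
  also have "\<dots> = (SUP p\<in>Y. \<integral>\<^sup>+ x. g x \<partial>measure_spmf p)"
    by (auto simp: nn_integral_measure_spmf nn_integral_count_space_indicator set_lub_spmf[OF chain]
        in_set_spmf_iff_spmf intro!: arg_cong [of _ _ Sup] image_cong nn_integral_cong split: split_indicator)
  finally show ?thesis .
qed

text \<open>Upper bounds on integrals survive suprema of chains, which is what fixed point induction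
  on \<open>run\<close> requires.\<close>

lemma admissible_nn_integral_le:
  "spmf.admissible (\<lambda>r. (\<integral>\<^sup>+ y. g y \<partial>measure_spmf (r x)) \<le> B)"
proof (rule ccpo.admissibleI)
  fix A :: "('a \<Rightarrow> 'b spmf) set"
  assume A: "Complete_Partial_Order.chain spmf.le_fun A" "A \<noteq> {}"
    and le: "\<forall>r\<in>A. (\<integral>\<^sup>+ y. g y \<partial>measure_spmf (r x)) \<le> B"
  have chain: "Complete_Partial_Order.chain (ord_spmf (=)) {y. \<exists>f\<in>A. y = f x}"
    using A(1) by (rule chain_fun)
  have "(\<integral>\<^sup>+ y. g y \<partial>measure_spmf (spmf.lub_fun A x)) = (SUP p\<in>{y. \<exists>f\<in>A. y = f x}. \<integral>\<^sup>+ y. g y \<partial>measure_spmf p)"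
    unfolding fun_lub_def using A(2) by (intro nn_integral_lub_spmf chain) auto
  also have "\<dots> \<le> B"
    using le by (intro SUP_least) auto
  finally show "(\<integral>\<^sup>+ y. g y \<partial>measure_spmf (spmf.lub_fun A x)) \<le> B" .
qed

lemma nn_integral_measure_spmf_option:
  "(\<integral>\<^sup>+ x. g x \<partial>measure_spmf p) = (\<integral>\<^sup>+ x. (case x of None \<Rightarrow> 0 | Some y \<Rightarrow> g y) \<partial>measure_pmf p)"
  by (simp add: nn_integral_measure_spmf_conv_measure_pmf nn_integral_restrict_space)
     (auto intro!: nn_integral_cong split: option.splits split_indicator)

text \<open>While all queries stay in \<open>G\<close> the oracles agree and the executions
  coincide. After a query outside \<open>G\<close>, or if the execution against \<open>orc\<close>
  never ends, the right-hand side charges the maximal value \<open>M\<close>. The induction is on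
  the execution against \<open>orc'\<close>.\<close>

lemma nn_integral_run_le_transcript:
  fixes w :: "(nat \<Rightarrow> nat set) \<Rightarrow> ennreal"
  assumes agree: "\<And>Q. Q \<in> G \<Longrightarrow> orc Q = orc' Q" and M: "\<And>S. w S \<le> M"
  shows "(\<integral>\<^sup>+ (S, q, t). w S \<partial>measure_spmf (run orc' a)) \<le>
    (\<integral>\<^sup>+ x. (case x of None \<Rightarrow> M | Some (S, Qs) \<Rightarrow> if set Qs \<subseteq> G then w S else M) \<partial>measure_pmf (transcript orc a))"
proof -
  let ?h = "\<lambda>x. case x of None \<Rightarrow> M | Some (S, Qs) \<Rightarrow> if set Qs \<subseteq> G then w S else M"
  have "\<forall>a. (\<integral>\<^sup>+ (S, q, t). w S \<partial>measure_spmf (run orc' a)) \<le> (\<integral>\<^sup>+ x. ?h x \<partial>measure_pmf (transcript orc a))"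
  proof (induction rule: run.fixp_induct)
    case 1
    show ?case
      unfolding curry_def by (intro admissible_all admissible_nn_integral_le)
  next
    case 2
    show ?case by simp
  next
    case (3 r)
    have le_M: "(\<integral>\<^sup>+ x. w (fst x) \<partial>measure_spmf p) \<le> M" for p :: "((nat \<Rightarrow> nat set) \<times> nat \<times> nat) spmf"
    proof -
      have "(\<integral>\<^sup>+ x. w (fst x) \<partial>measure_spmf p) \<le> (\<integral>\<^sup>+ x. M \<partial>measure_spmf p)"
        by (intro nn_integral_mono M)
      also have "\<dots> \<le> M * 1"
        by (simp only: nn_integral_const) (intro mult_left_mono measure_spmf.emeasure_space_le_1, simp)
      finally show ?thesis by simp
    qed
    have step: "(\<integral>\<^sup>+ (S, q, t). w S \<partial>measure_spmf (map_spmf (\<lambda>(S, q, t). (S, f q, g t)) p)) =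
        (\<integral>\<^sup>+ (S, q, t). w S \<partial>measure_spmf p)" for f g :: "nat \<Rightarrow> nat" and p :: "((nat \<Rightarrow> nat set) \<times> nat \<times> nat) spmf"
      by (simp add: case_prod_beta' o_def)
    show ?case
    proof
      fix a
      show "(\<integral>\<^sup>+ (S, q, t). w S \<partial>measure_spmf (case a of Output S \<Rightarrow> return_spmf (S, 0, 0)
          | Query Q c \<Rightarrow> map_spmf (\<lambda>(S, q, t). (S, Suc q, Suc t)) (r orc' (c (orc' Q)))
          | Random p \<Rightarrow> map_spmf (\<lambda>(S, q, t). (S, q, Suc t)) (spmf_of_pmf p \<bind> r orc')
          | Internal b \<Rightarrow> map_spmf (\<lambda>(S, q, t). (S, q, Suc t)) (r orc' b))) \<le> (\<integral>\<^sup>+ x. ?h x \<partial>measure_pmf (transcript orc a))"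
      proof (cases a)
        case (Output S)
        then show ?thesis
          by (simp add: nn_integral_measure_spmf_option)
      next
        case (Query Q c)
        show ?thesis
        proof (cases "Q \<in> G")
          case True
          have "?h (map_option (apsnd ((#) Q)) x) = ?h x" for x
            using True by (auto split: option.splits)
          then have "(\<integral>\<^sup>+ x. ?h x \<partial>measure_pmf (transcript orc a)) = (\<integral>\<^sup>+ x. ?h x \<partial>measure_pmf (transcript orc (c (orc' Q))))"
            using Query agree[OF True] by simp
          then show ?thesis
            using 3[rule_format, of "c (orc' Q)"] Query by (simp only: alg.case step)
        next
          case False
          \<comment> \<open>From here on the answers may differ, but the transcript already contains
            \<open>Q\<close>, so its side equals \<open>M\<close>, the most that any execution can
            yield.\<close>
          have "?h (map_option (apsnd ((#) Q)) x) = M" for x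
            using False by (auto split: option.splits)
          then have "(\<integral>\<^sup>+ x. ?h x \<partial>measure_pmf (transcript orc a)) = M"
            using Query by simp
          then show ?thesis
            using le_M Query by (simp only: alg.case step) (simp add: case_prod_beta')
        qed
      next
        case (Random p)
        have "(\<integral>\<^sup>+ (S, q, t). w S \<partial>measure_spmf (spmf_of_pmf p \<bind> r orc')) =
            (\<integral>\<^sup>+ b. \<integral>\<^sup>+ (S, q, t). w S \<partial>measure_spmf (r orc' b) \<partial>measure_pmf p)"
          by (simp add: nn_integral_measure_spmf_option)
        also have "\<dots> \<le> (\<integral>\<^sup>+ b. \<integral>\<^sup>+ x. ?h x \<partial>measure_pmf (transcript orc b) \<partial>measure_pmf p)"
          by (intro nn_integral_mono 3[rule_format])
        also have "\<dots> = (\<integral>\<^sup>+ x. ?h x \<partial>measure_pmf (transcript orc a))"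
          using Random by simp
        finally show ?thesis
          using Random by (simp only: alg.case step[where f = "\<lambda>q. q"])
      next
        case (Internal b)
        then show ?thesis
          using 3[rule_format, of b] by (simp only: alg.case step[where f = "\<lambda>q. q"] transcript_simps)
      qed
    qed
  qed
  then show ?thesis by blast
qed

section \<open>A slowly varying cut-off\<close>

text \<open>Only \<open>x = 0\<close> needs care; there an exponent of at least two makes the
  difference quotient tend to zero from both sides.\<close>

lemma has_real_derivative_max_0_power:
  "((\<lambda>x. max 0 x ^ Suc (Suc n)) has_real_derivative real (Suc (Suc n)) * max 0 x ^ Suc n) (at x)"
proof (cases "x = 0")
  case True
  have "((\<lambda>h. (max 0 (0 + h) ^ Suc (Suc n) - max 0 0 ^ Suc (Suc n)) / h) \<longlongrightarrow> 0) (at (0::real))"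
  proof (rule Lim_null_comparison)
    show "\<forall>\<^sub>F h in at 0. norm ((max 0 (0 + h) ^ Suc (Suc n) - max 0 0 ^ Suc (Suc n)) / h) \<le> \<bar>h\<bar> ^ Suc n"
      by (rule always_eventually) (auto simp: max_def abs_mult mult_nonpos_nonneg)
    show "((\<lambda>h. \<bar>h\<bar> ^ Suc n) \<longlongrightarrow> 0) (at (0::real))"
      by (auto intro!: tendsto_eq_intros)
  qed
  then show ?thesis
    using True by (simp add: DERIV_def)
next
  case False
  then consider "x < 0" | "x > 0" by linarith
  then show ?thesis
  proof cases
    case 1
    have "((\<lambda>_. 0) has_real_derivative 0) (at x)" by simp
    then have "((\<lambda>x. max 0 x ^ Suc (Suc n)) has_real_derivative 0) (at x)"
      by (rule DERIV_cong_ev[THEN iffD1, rotated -1])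
         (use 1 in \<open>auto intro!: eventually_mono[OF eventually_nhds_in_open[of "{..<0}"]]\<close>)
    then show ?thesis using 1 by simp
  next
    case 2
    have "((\<lambda>x. x ^ Suc (Suc n)) has_real_derivative real (Suc (Suc n)) * x ^ Suc n) (at x)"
      using DERIV_pow[of "Suc (Suc n)" x] by (simp del: power_Suc)
    then have "((\<lambda>x. max 0 x ^ Suc (Suc n)) has_real_derivative real (Suc (Suc n)) * x ^ Suc n) (at x)"
      by (rule DERIV_cong_ev[THEN iffD1, rotated -1])
         (use 2 in \<open>auto intro!: eventually_mono[OF eventually_nhds_in_open[of "{0<..}"]]\<close>)
    then show ?thesis using 2 by simp
  qed
qed

text \<open>
  \<open>decay \<gamma> \<delta> t\<close> is \<open>(2 * \<delta> / (t + \<delta>)) powr \<gamma>\<close>, which exceeds \<open>1\<close> exactly for \<open>t < \<delta>\<close>; the shift by \<open>\<delta>\<close>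
  avoids the singularity at \<open>t = 0\<close>. The cube in \<open>ramp\<close> makes the cut-off twice differentiable.
\<close>

definition decay :: "real \<Rightarrow> real \<Rightarrow> real \<Rightarrow> real" where
  "decay \<gamma> \<delta> t = exp (\<gamma> * (ln (2 * \<delta>) - ln (t + \<delta>)))"

definition ramp :: "real \<Rightarrow> real \<Rightarrow> real \<Rightarrow> real" where
  "ramp \<gamma> \<delta> t = max 0 (1 - decay \<gamma> \<delta> t) ^ 3"

definition ramp' :: "real \<Rightarrow> real \<Rightarrow> real \<Rightarrow> real" where
  "ramp' \<gamma> \<delta> t = 3 * max 0 (1 - decay \<gamma> \<delta> t) ^ 2 * (\<gamma> * decay \<gamma> \<delta> t / (t + \<delta>))"

definition ramp'' :: "real \<Rightarrow> real \<Rightarrow> real \<Rightarrow> real" where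
  "ramp'' \<gamma> \<delta> t = 6 * max 0 (1 - decay \<gamma> \<delta> t) * (\<gamma> * decay \<gamma> \<delta> t / (t + \<delta>))\<^sup>2
     - 3 * max 0 (1 - decay \<gamma> \<delta> t) ^ 2 * ((\<gamma>\<^sup>2 + \<gamma>) * decay \<gamma> \<delta> t / (t + \<delta>)\<^sup>2)"

lemma decay_pos: "decay \<gamma> \<delta> t > 0"
  by (simp add: decay_def)

lemma has_real_derivative_decay:
  assumes "0 < \<delta>" "0 \<le> t"
  shows "(decay \<gamma> \<delta> has_real_derivative - (\<gamma> * decay \<gamma> \<delta> t / (t + \<delta>))) (at t)"
  unfolding decay_def[abs_def] using assms by (auto intro!: derivative_eq_intros)

lemma has_real_derivative_max_decay:
  assumes "0 < \<delta>" "0 \<le> t"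
  shows "((\<lambda>t. max 0 (1 - decay \<gamma> \<delta> t) ^ Suc (Suc n)) has_real_derivative
    real (Suc (Suc n)) * max 0 (1 - decay \<gamma> \<delta> t) ^ Suc n * (\<gamma> * decay \<gamma> \<delta> t / (t + \<delta>))) (at t)"
proof -
  have "((\<lambda>t. 1 - decay \<gamma> \<delta> t) has_real_derivative \<gamma> * decay \<gamma> \<delta> t / (t + \<delta>)) (at t)"
    using has_real_derivative_decay[OF assms] by (auto intro!: derivative_eq_intros)
  from DERIV_chain2[OF has_real_derivative_max_0_power this] show ?thesis
    by simp
qed

lemma has_real_derivative_ramp:
  assumes "0 < \<delta>" "0 \<le> t"
  shows "(ramp \<gamma> \<delta> has_real_derivative ramp' \<gamma> \<delta> t) (at t)"
  using has_real_derivative_max_decay[OF assms, of \<gamma> 1]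
  by (simp add: ramp_def[abs_def] ramp'_def numeral_3_eq_3 numeral_2_eq_2)

lemma has_real_derivative_ramp':
  assumes "0 < \<delta>" "0 \<le> t"
  shows "(ramp' \<gamma> \<delta> has_real_derivative ramp'' \<gamma> \<delta> t) (at t)"
proof -
  have d: "((\<lambda>t. max 0 (1 - decay \<gamma> \<delta> t) ^ 2) has_real_derivative
      2 * max 0 (1 - decay \<gamma> \<delta> t) * (\<gamma> * decay \<gamma> \<delta> t / (t + \<delta>))) (at t)"
    using has_real_derivative_max_decay[OF assms, of \<gamma> 0] by (simp add: numeral_2_eq_2)
  have e: "((\<lambda>t. \<gamma> * decay \<gamma> \<delta> t / (t + \<delta>)) has_real_derivative
      - ((\<gamma>\<^sup>2 + \<gamma>) * decay \<gamma> \<delta> t / (t + \<delta>)\<^sup>2)) (at t)"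
    using assms
    by (auto intro!: derivative_eq_intros has_real_derivative_decay simp: divide_simps power2_eq_square)
       (simp add: algebra_simps)
  show ?thesis
    unfolding ramp'_def[abs_def] ramp''_def
    by (rule DERIV_cong[OF DERIV_mult[OF DERIV_cmult[OF d, of 3] e]]) (simp add: power2_eq_square algebra_simps)
qed

lemma ramp_bounds: "0 \<le> ramp \<gamma> \<delta> t" "ramp \<gamma> \<delta> t \<le> 1"
  using decay_pos[of \<gamma> \<delta> t] by (auto simp: ramp_def power_le_one)

lemma ramp_eq_0:
  assumes "0 < \<delta>" "0 \<le> t" "t \<le> \<delta>" "0 \<le> \<gamma>"
  shows "ramp \<gamma> \<delta> t = 0"
proof -
  have "decay \<gamma> \<delta> t \<ge> 1"
    using assms by (simp add: decay_def)
  then show ?thesis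
    by (simp add: ramp_def)
qed

lemma ramp_ge:
  shows "1 - 3 * decay \<gamma> \<delta> t \<le> ramp \<gamma> \<delta> t"
proof (cases "decay \<gamma> \<delta> t \<le> 1")
  case True
  then show ?thesis
    using Bernoulli_inequality[of "- decay \<gamma> \<delta> t" 3] by (simp add: ramp_def)
next
  case False
  then show ?thesis
    by (simp add: ramp_def)
qed

text \<open>On the logarithmic scale the cut-off has slope of order \<open>\<gamma>\<close>:
  \<open>t / (t + \<delta>)\<close> is at most one, and the cut-off is constant where
  \<open>decay\<close> exceeds one. The bound is free of \<open>\<delta>\<close>, so
  \<open>\<gamma>\<close> can be fixed before \<open>\<delta>\<close> is made small.\<close>

lemma ramp'_bound:
  assumes "0 < \<delta>" "0 \<le> t" "0 \<le> \<gamma>" "\<gamma> \<le> 1"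
  shows "\<bar>t * ramp' \<gamma> \<delta> t\<bar> \<le> 12 * \<gamma>"
proof (cases "decay \<gamma> \<delta> t \<le> 1")
  case True
  define q where "q = decay \<gamma> \<delta> t"
  define r where "r = t / (t + \<delta>)"
  have q: "0 \<le> q" "q \<le> 1" and r: "0 \<le> r" "r \<le> 1"
    using decay_pos[of \<gamma> \<delta> t] True assms by (auto simp: q_def r_def)
  have "t * ramp' \<gamma> \<delta> t = \<gamma> * (3 * ((1 - q)\<^sup>2 * (q * r)))"
    using q by (simp add: ramp'_def q_def[symmetric] r_def)
  moreover have "(1 - q)\<^sup>2 * (q * r) \<le> 1"
    using q r by (intro mult_le_one power_le_one) auto
  moreover have "0 \<le> (1 - q)\<^sup>2 * (q * r)"
    using q r by auto
  ultimately show ?thesis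
    using assms mult_left_mono[of "3 * ((1 - q)\<^sup>2 * (q * r))" 12 \<gamma>] by (simp add: mult.commute)
next
  case False
  then show ?thesis
    using assms by (simp add: ramp'_def)
qed

lemma ramp''_bound:
  assumes "0 < \<delta>" "0 \<le> t" "0 \<le> \<gamma>" "\<gamma> \<le> 1"
  shows "\<bar>t\<^sup>2 * ramp'' \<gamma> \<delta> t\<bar> \<le> 12 * \<gamma>"
proof (cases "decay \<gamma> \<delta> t \<le> 1")
  case True
  define q where "q = decay \<gamma> \<delta> t"
  define r where "r = t / (t + \<delta>)"
  have q: "0 \<le> q" "q \<le> 1" and r: "0 \<le> r" "r \<le> 1"
    using decay_pos[of \<gamma> \<delta> t] True assms by (auto simp: q_def r_def)
  have eq: "t\<^sup>2 * ramp'' \<gamma> \<delta> t = \<gamma> * (6 * (\<gamma> * ((1 - q) * (q * r)\<^sup>2)) - 3 * ((\<gamma> + 1) * ((1 - q)\<^sup>2 * (q * r\<^sup>2))))"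
    using q by (simp add: ramp''_def q_def[symmetric] r_def power2_eq_square algebra_simps)
  have 1: "0 \<le> \<gamma> * ((1 - q) * (q * r)\<^sup>2)" "\<gamma> * ((1 - q) * (q * r)\<^sup>2) \<le> 1"
    using q r assms by (auto intro!: mult_le_one power_le_one)
  have 2: "0 \<le> (1 - q)\<^sup>2 * (q * r\<^sup>2)" "(1 - q)\<^sup>2 * (q * r\<^sup>2) \<le> 1"
    using q r by (auto intro!: mult_le_one power_le_one)
  have 3: "0 \<le> (\<gamma> + 1) * ((1 - q)\<^sup>2 * (q * r\<^sup>2))" "(\<gamma> + 1) * ((1 - q)\<^sup>2 * (q * r\<^sup>2)) \<le> 2"
    using 2 assms mult_mono[of "\<gamma> + 1" 2 "(1 - q)\<^sup>2 * (q * r\<^sup>2)" 1] by auto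
  \<comment> \<open>A crude triangle bound: 6 * 1 + 3 * 2 = 12.\<close>
  have "\<bar>6 * (\<gamma> * ((1 - q) * (q * r)\<^sup>2)) - 3 * ((\<gamma> + 1) * ((1 - q)\<^sup>2 * (q * r\<^sup>2)))\<bar> \<le> 12"
    using 1 3 by linarith
  then show ?thesis
    unfolding eq using assms by (simp only: abs_mult) (simp add: mult_left_mono mult.commute)
next
  case False
  then show ?thesis
    using assms by (simp add: ramp''_def)
qed

section \<open>Dispersion and the gap between power mean and product\<close>

definition mean :: "nat \<Rightarrow> (nat \<Rightarrow> real) \<Rightarrow> real" where
  "mean k v = (\<Sum>l<k. v l) / real k"

definition dispersion :: "nat \<Rightarrow> (nat \<Rightarrow> real) \<Rightarrow> real" where
  "dispersion k v = (\<Sum>l<k. (v l - mean k v)\<^sup>2)"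

definition gap :: "nat \<Rightarrow> (nat \<Rightarrow> real) \<Rightarrow> real" where
  "gap k v = mean k v ^ k - (\<Prod>l<k. v l)"

definition gap' :: "nat \<Rightarrow> nat \<Rightarrow> (nat \<Rightarrow> real) \<Rightarrow> real" where
  "gap' k i v = mean k v ^ (k - 1) - (\<Prod>l\<in>{..<k} - {i}. v l)"

text \<open>The product is affine in each coordinate, so its second derivative in a single
  coordinate is zero. Each differentiation of the mean contributes
  \<open>1 / real k\<close>.\<close>

definition gap'' :: "nat \<Rightarrow> nat \<Rightarrow> nat \<Rightarrow> (nat \<Rightarrow> real) \<Rightarrow> real" where
  "gap'' k i j v = real (k - 1) / real k * mean k v ^ (k - 2)
     - (if i = j then 0 else \<Prod>l\<in>{..<k} - {i} - {j}. v l)"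

lemma sum_fun_upd:
  fixes v :: "nat \<Rightarrow> real"
  assumes "j < k"
  shows "(\<Sum>l<k. g ((v(j := x)) l)) = g x + (\<Sum>l\<in>{..<k} - {j}. g (v l) :: real)"
  using assms by (subst sum.remove[of _ j]) auto

lemma prod_fun_upd:
  fixes v :: "nat \<Rightarrow> real"
  assumes "finite A" "j \<in> A"
  shows "(\<Prod>l\<in>A. (v(j := x)) l) = x * (\<Prod>l\<in>A - {j}. v l)"
  using assms by (subst prod.remove[of _ j]) auto

lemma dispersion_altdef:
  assumes "k > 0"
  shows "dispersion k v = (\<Sum>l<k. (v l)\<^sup>2) - (\<Sum>l<k. v l)\<^sup>2 / real k"
proof -
  have "dispersion k v = (\<Sum>l<k. (v l)\<^sup>2 - 2 * mean k v * v l + (mean k v)\<^sup>2)"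
    unfolding dispersion_def by (intro sum.cong refl) (simp add: power2_eq_square algebra_simps)
  also have "\<dots> = (\<Sum>l<k. (v l)\<^sup>2) - 2 * mean k v * (\<Sum>l<k. v l) + real k * (mean k v)\<^sup>2"
    by (simp add: sum.distrib sum_subtractf sum_distrib_left)
  also have "(\<Sum>l<k. v l) = real k * mean k v"
    using assms by (simp add: mean_def)
  finally show ?thesis
    using assms by (simp add: mean_def power2_eq_square divide_simps)
qed

lemma has_real_derivative_mean:
  assumes "j < k"
  shows "((\<lambda>x. mean k (v(j := x))) has_real_derivative 1 / real k) (at x)"
  unfolding mean_def sum_fun_upd[OF assms, of "\<lambda>y. y"] using assms by (auto intro!: derivative_eq_intros)

text \<open>The motion of the mean has no first-order effect because the deviations sum to zero;
  only the moved coordinate contributes.\<close>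

lemma has_real_derivative_dispersion:
  assumes "j < k"
  shows "((\<lambda>x. dispersion k (v(j := x))) has_real_derivative 2 * (x - mean k (v(j := x)))) (at x)"
proof -
  have k: "k > 0" using assms by simp
  show ?thesis
    unfolding dispersion_altdef[OF k] mean_def sum_fun_upd[OF assms, of "\<lambda>y. y"] sum_fun_upd[OF assms, of "\<lambda>y. y\<^sup>2"]
    using assms by (auto intro!: derivative_eq_intros simp: field_simps)
qed

lemma has_real_derivative_gap:
  assumes "j < k"
  shows "((\<lambda>x. gap k (v(j := x))) has_real_derivative gap' k j (v(j := x))) (at x)"
proof -
  have *: "(\<Prod>l<k. (v(j := x)) l) = x * (\<Prod>l\<in>{..<k} - {j}. v l)" for x
    using assms by (intro prod_fun_upd) auto
  have "(\<Prod>l\<in>{..<k} - {j}. (v(j := x)) l) = (\<Prod>l\<in>{..<k} - {j}. v l)"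
    by (intro prod.cong) auto
  moreover note DERIV_diff[OF DERIV_power[OF has_real_derivative_mean[OF assms, of v x], of k]
    DERIV_cmult_right[OF DERIV_ident, of "\<Prod>l\<in>{..<k} - {j}. v l"]]
  ultimately show ?thesis
    using assms unfolding gap_def gap'_def * by simp
qed

lemma has_real_derivative_gap':
  assumes "j < k" "i < k"
  shows "((\<lambda>x. gap' k i (v(j := x))) has_real_derivative gap'' k i j (v(j := x))) (at x)"
proof -
  have m: "((\<lambda>x. mean k (v(j := x)) ^ (k - 1)) has_real_derivative
      real (k - 1) / real k * mean k (v(j := x)) ^ (k - 2)) (at x)"
    using DERIV_power[OF has_real_derivative_mean[OF assms(1), of v x], of "k - 1"]
    by (simp add: numeral_2_eq_2 mult_ac)
  have "((\<lambda>x. \<Prod>l\<in>{..<k} - {i}. (v(j := x)) l) has_real_derivative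
     (if i = j then 0 else \<Prod>l\<in>{..<k} - {i} - {j}. (v(j := x)) l)) (at x)"
  proof (cases "i = j")
    case True
    have "(\<Prod>l\<in>{..<k} - {i}. (v(j := x)) l) = (\<Prod>l\<in>{..<k} - {i}. v l)" for x
      using True by (intro prod.cong) auto
    then show ?thesis
      using True by simp
  next
    case False
    have "(\<Prod>l\<in>{..<k} - {i}. (v(j := x)) l) = x * (\<Prod>l\<in>{..<k} - {i} - {j}. v l)" for x
      using False assms by (intro prod_fun_upd) auto
    moreover have "(\<Prod>l\<in>{..<k} - {i} - {j}. (v(j := x)) l) = (\<Prod>l\<in>{..<k} - {i} - {j}. v l)"
      by (intro prod.cong) auto
    moreover have "((\<lambda>x. x * (\<Prod>l\<in>{..<k} - {i} - {j}. v l)) has_real_derivative (\<Prod>l\<in>{..<k} - {i} - {j}. v l)) (at x)"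
      by (auto intro!: derivative_eq_intros)
    ultimately show ?thesis
      using False by simp
  qed
  from DERIV_diff[OF m this] show ?thesis
    by (simp add: gap'_def gap''_def)
qed

lemma dispersion_nonneg: "dispersion k v \<ge> 0"
  by (simp add: dispersion_def sum_nonneg)

lemma abs_deviation_le: "i < k \<Longrightarrow> \<bar>v i - mean k v\<bar> \<le> sqrt (dispersion k v)"
  unfolding dispersion_def
  by (intro real_le_rsqrt) (auto intro!: member_le_sum[of i "{..<k}" "\<lambda>l. (v l - mean k v)\<^sup>2"])

lemma sum_deviations_le:
  assumes "A \<subseteq> {..<k}"
  shows "(\<Sum>l\<in>A. \<bar>v l - mean k v\<bar>) \<le> real k * sqrt (dispersion k v)"
proof -
  have "(\<Sum>l\<in>A. \<bar>v l - mean k v\<bar>) \<le> real (card A) * sqrt (dispersion k v)"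
    using assms by (intro sum_bounded_above abs_deviation_le) auto
  also have "\<dots> \<le> real k * sqrt (dispersion k v)"
    using card_mono[OF _ assms] dispersion_nonneg by (intro mult_right_mono) auto
  finally show ?thesis .
qed

lemma abs_prod_diff_power_le:
  fixes v :: "'a \<Rightarrow> real"
  assumes "finite A" "\<And>l. l \<in> A \<Longrightarrow> \<bar>v l\<bar> \<le> 1" "\<bar>m\<bar> \<le> 1"
  shows "\<bar>(\<Prod>l\<in>A. v l) - m ^ card A\<bar> \<le> (\<Sum>l\<in>A. \<bar>v l - m\<bar>)"
  using norm_prod_diff[of A v "\<lambda>_. m"] assms by (simp add: power_abs)

text \<open>Taylor expansion of a product around the constant vector \<open>m\<close> with quadratic
  remainder. At the mean the linear term vanishes, which is why \<open>gap\<close> is of the order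
  of the dispersion and not of its square root.\<close>

lemma abs_prod_diff_linear_le:
  fixes v :: "'a \<Rightarrow> real"
  assumes "finite A" "\<And>l. l \<in> A \<Longrightarrow> \<bar>v l\<bar> \<le> 1" "\<bar>m\<bar> \<le> 1"
  shows "\<bar>(\<Prod>l\<in>A. v l) - m ^ card A - m ^ (card A - 1) * (\<Sum>l\<in>A. v l - m)\<bar> \<le> (\<Sum>l\<in>A. \<bar>v l - m\<bar>)\<^sup>2"
  using assms(1,2)
proof (induction A rule: finite_induct)
  case (insert a A)
  let ?d = "\<Sum>l\<in>A. \<bar>v l - m\<bar>"
  let ?E = "(\<Prod>l\<in>A. v l) - m ^ card A - m ^ (card A - 1) * (\<Sum>l\<in>A. v l - m)"
  have IH: "\<bar>?E\<bar> \<le> ?d\<^sup>2"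
    using insert by auto
  have P: "\<bar>(\<Prod>l\<in>A. v l) - m ^ card A\<bar> \<le> ?d"
    using insert assms by (intro abs_prod_diff_power_le) auto
  have d: "?d \<ge> 0"
    by (rule sum_nonneg) simp
  \<comment> \<open>For empty \<open>A\<close> the exponent \<open>card A - 1\<close> is truncated
    to 0, but the sum that it multiplies is then zero.\<close>
  have pow: "m * m ^ (card A - 1) * (\<Sum>l\<in>A. v l - m) = m ^ card A * (\<Sum>l\<in>A. v l - m)"
  proof (cases "A = {}")
    case False
    then have "card A = Suc (card A - 1)"
      using insert.hyps by (simp add: card_gt_0_iff)
    then show ?thesis
      by (metis power_Suc)
  qed simp
  \<comment> \<open>Writing the new factor as \<open>m + (v a - m)\<close> leaves \<open>m\<close>
    times the old remainder and a cross term, to which the first-order bound \<open>P\<close>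
    applies.\<close>
  have "(\<Prod>l\<in>insert a A. v l) - m ^ card (insert a A) - m ^ (card (insert a A) - 1) * (\<Sum>l\<in>insert a A. v l - m)
     = m * ?E + (v a - m) * ((\<Prod>l\<in>A. v l) - m ^ card A)"
  proof -
    have mE: "m * ?E = m * (\<Prod>l\<in>A. v l) - m * m ^ card A - m ^ card A * (\<Sum>l\<in>A. v l - m)"
      by (simp only: right_diff_distrib mult.assoc[symmetric] pow)
    show ?thesis
      unfolding mE using insert.hyps by (simp add: algebra_simps)
  qed
  also have "\<bar>\<dots>\<bar> \<le> \<bar>m\<bar> * \<bar>?E\<bar> + \<bar>v a - m\<bar> * \<bar>(\<Prod>l\<in>A. v l) - m ^ card A\<bar>"
    unfolding abs_mult[symmetric] by (rule abs_triangle_ineq)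
  also have "\<dots> \<le> 1 * ?d\<^sup>2 + \<bar>v a - m\<bar> * ?d"
    using IH P assms(3) d by (intro add_mono mult_mono) auto
  also have "\<dots> \<le> (\<bar>v a - m\<bar> + ?d)\<^sup>2"
  proof -
    have "1 * y\<^sup>2 + x * y \<le> (x + y)\<^sup>2" if "x \<ge> 0" "y \<ge> 0" for x y :: real
      using that by (simp add: power2_eq_square algebra_simps)
    then show ?thesis
      using d by simp
  qed
  finally show ?case
    using insert.hyps by simp
qed simp

lemma mean_bounds:
  assumes "\<And>l. l < k \<Longrightarrow> 0 \<le> v l \<and> v l \<le> 1"
  shows "0 \<le> mean k v" "mean k v \<le> 1"
proof -
  show "0 \<le> mean k v"
    unfolding mean_def using assms by (auto intro!: divide_nonneg_nonneg sum_nonneg)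
  have "(\<Sum>l<k. v l) \<le> real (card {..<k}) * 1"
    using assms by (intro sum_bounded_above) auto
  then show "mean k v \<le> 1"
    unfolding mean_def by (cases "k = 0") auto
qed

lemma gap_bound:
  assumes "\<And>l. l < k \<Longrightarrow> 0 \<le> v l \<and> v l \<le> 1"
  shows "\<bar>gap k v\<bar> \<le> (real k)\<^sup>2 * dispersion k v"
proof (cases "k = 0")
  case False
  have m: "\<bar>mean k v\<bar> \<le> 1"
    using mean_bounds[of k v] assms by auto
  have "(\<Sum>l<k. v l - mean k v) = 0"
    using False by (simp add: sum_subtractf mean_def)
  then have "\<bar>gap k v\<bar> \<le> (\<Sum>l<k. \<bar>v l - mean k v\<bar>)\<^sup>2"
    using abs_prod_diff_linear_le[of "{..<k}" v "mean k v"] assms m by (auto simp: gap_def abs_minus_commute)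
  also have "\<dots> \<le> (real k * sqrt (dispersion k v))\<^sup>2"
    by (intro power_mono sum_deviations_le sum_nonneg) auto
  finally show ?thesis
    by (simp add: power_mult_distrib dispersion_nonneg)
qed (simp add: gap_def dispersion_def)

lemma gap'_bound:
  assumes "\<And>l. l < k \<Longrightarrow> 0 \<le> v l \<and> v l \<le> 1" "i < k"
  shows "\<bar>gap' k i v\<bar> \<le> real k * sqrt (dispersion k v)"
proof -
  have m: "\<bar>mean k v\<bar> \<le> 1"
    using mean_bounds[of k v] assms by auto
  have "\<bar>gap' k i v\<bar> \<le> (\<Sum>l\<in>{..<k} - {i}. \<bar>v l - mean k v\<bar>)"
    using abs_prod_diff_power_le[of "{..<k} - {i}" v "mean k v"] assms m by (simp add: gap'_def abs_minus_commute)
  also have "\<dots> \<le> real k * sqrt (dispersion k v)"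
    by (rule sum_deviations_le) auto
  finally show ?thesis .
qed

section \<open>Second differences of the interpolation\<close>

text \<open>This is the power of the mean where the ramp is 0 and the plain product where the ramp
  is 1.\<close>

definition blend :: "nat \<Rightarrow> real \<Rightarrow> real \<Rightarrow> (nat \<Rightarrow> real) \<Rightarrow> real" where
  "blend k \<gamma> \<delta> v = mean k v ^ k - ramp \<gamma> \<delta> (dispersion k v) * gap k v"

definition blend' :: "nat \<Rightarrow> real \<Rightarrow> real \<Rightarrow> nat \<Rightarrow> (nat \<Rightarrow> real) \<Rightarrow> real" where
  "blend' k \<gamma> \<delta> i v = mean k v ^ (k - 1)
     - (ramp' \<gamma> \<delta> (dispersion k v) * (2 * (v i - mean k v)) * gap k v
        + ramp \<gamma> \<delta> (dispersion k v) * gap' k i v)"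

definition blend'' :: "nat \<Rightarrow> real \<Rightarrow> real \<Rightarrow> nat \<Rightarrow> nat \<Rightarrow> (nat \<Rightarrow> real) \<Rightarrow> real" where
  "blend'' k \<gamma> \<delta> i j v = real (k - 1) / real k * mean k v ^ (k - 2)
     - (ramp'' \<gamma> \<delta> (dispersion k v) * (2 * (v j - mean k v)) * (2 * (v i - mean k v)) * gap k v
        + ramp' \<gamma> \<delta> (dispersion k v) * (2 * ((if i = j then 1 else 0) - 1 / real k)) * gap k v
        + ramp' \<gamma> \<delta> (dispersion k v) * (2 * (v i - mean k v)) * gap' k j v
        + ramp' \<gamma> \<delta> (dispersion k v) * (2 * (v j - mean k v)) * gap' k i v
        + ramp \<gamma> \<delta> (dispersion k v) * gap'' k i j v)"

lemma has_real_derivative_blend: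
  assumes "j < k" "0 < \<delta>"
  shows "((\<lambda>x. blend k \<gamma> \<delta> (v(j := x))) has_real_derivative blend' k \<gamma> \<delta> j (v(j := x))) (at x)"
proof -
  note r = DERIV_chain2[OF has_real_derivative_ramp[OF assms(2) dispersion_nonneg] has_real_derivative_dispersion[OF assms(1)]]
  note d = DERIV_diff[OF DERIV_power[OF has_real_derivative_mean[OF assms(1)], where n = k]
      DERIV_mult[OF r has_real_derivative_gap[OF assms(1)]]]
  show ?thesis
    unfolding blend_def blend'_def
    by (rule DERIV_cong[OF d]) (use assms in \<open>simp add: algebra_simps\<close>)
qed

lemma has_real_derivative_blend':
  assumes "j < k" "i < k" "0 < \<delta>"
  shows "((\<lambda>x. blend' k \<gamma> \<delta> i (v(j := x))) has_real_derivative blend'' k \<gamma> \<delta> i j (v(j := x))) (at x)"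
proof -
  note D = has_real_derivative_dispersion[OF assms(1), of v x]
  note r = DERIV_chain2[OF has_real_derivative_ramp[OF assms(3) dispersion_nonneg] D, of \<gamma>]
  note r' = DERIV_chain2[OF has_real_derivative_ramp'[OF assms(3) dispersion_nonneg] D, of \<gamma>]
  have c: "((\<lambda>x. (v(j := x)) i) has_real_derivative (if i = j then 1 else 0)) (at x)"
    by (cases "i = j") auto
  note e = DERIV_cmult[OF DERIV_diff[OF c has_real_derivative_mean[OF assms(1), of v x]], of 2]
  note d = DERIV_diff[OF DERIV_power[OF has_real_derivative_mean[OF assms(1), of v x], where n = "k - 1"]
      DERIV_add[OF DERIV_mult[OF DERIV_mult[OF r' e] has_real_derivative_gap[OF assms(1), of v x]]
        DERIV_mult[OF r has_real_derivative_gap'[OF assms(1,2), of v x]]]]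
  show ?thesis
    unfolding blend'_def blend''_def
    by (rule DERIV_cong[OF d]) (simp add: algebra_simps numeral_2_eq_2)
qed

text \<open>With D the dispersion, the two derivatives of the ramp are of order
  \<open>\<gamma>\<close> / D and \<open>\<gamma>\<close> / D^2. The gap is of order D, its first
  derivatives and the deviations are of order sqrt D, and these powers cancel, so every term with a
  derivative of the ramp is of order \<open>\<gamma>\<close>. The rest is a convex combination of
  two non-negative mixed derivatives.\<close>

lemma blend''_ge:
  assumes "2 \<le> k" "i < k" "j < k" "0 < \<delta>" "0 \<le> \<gamma>" "\<gamma> \<le> 1"
    and v: "\<And>l. l < k \<Longrightarrow> 0 \<le> v l \<and> v l \<le> 1"
  shows "- (120 * (real k)\<^sup>2 * \<gamma>) \<le> blend'' k \<gamma> \<delta> i j v"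
proof -
  define D where "D = dispersion k v"
  define s where "s = sqrt D"
  define R where "R = gap k v"
  define \<phi>1 where "\<phi>1 = ramp' \<gamma> \<delta> D"
  define \<phi>2 where "\<phi>2 = ramp'' \<gamma> \<delta> D"
  have D: "D \<ge> 0" "s * s = D" "s \<ge> 0"
    by (auto simp: D_def s_def dispersion_nonneg)
  have b1: "\<bar>\<phi>1\<bar> * D \<le> 12 * \<gamma>"
    using ramp'_bound[of \<delta> D \<gamma>] assms D by (simp add: \<phi>1_def abs_mult mult.commute)
  have b2: "\<bar>\<phi>2\<bar> * (D * D) \<le> 12 * \<gamma>"
    using ramp''_bound[of \<delta> D \<gamma>] assms D by (simp add: \<phi>2_def abs_mult mult.commute power2_eq_square)
  have R: "\<bar>R\<bar> \<le> (real k)\<^sup>2 * D"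
    unfolding R_def D_def by (rule gap_bound) (use v in auto)
  have R': "\<bar>gap' k l v\<bar> \<le> real k * s" if "l < k" for l
    unfolding s_def D_def by (rule gap'_bound) (use v that in auto)
  have dev: "\<bar>v l - mean k v\<bar> \<le> s" if "l < k" for l
    unfolding s_def D_def by (rule abs_deviation_le) fact
  have kk: "real k \<le> (real k)\<^sup>2" "0 \<le> real k"
    using assms(1) by (auto simp: power2_eq_square)
  have t1: "\<bar>\<phi>2 * (2 * (v j - mean k v)) * (2 * (v i - mean k v)) * R\<bar> \<le> 48 * (real k)\<^sup>2 * \<gamma>"
  proof -
    have "\<bar>\<phi>2 * (2 * (v j - mean k v)) * (2 * (v i - mean k v)) * R\<bar> =
       4 * \<bar>\<phi>2\<bar> * (\<bar>v j - mean k v\<bar> * \<bar>v i - mean k v\<bar> * \<bar>R\<bar>)"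
      by (simp only: abs_mult) simp
    also have "\<dots> \<le> 4 * \<bar>\<phi>2\<bar> * (s * s * ((real k)\<^sup>2 * D))"
      using dev assms R D by (intro mult_left_mono mult_mono) auto
    also have "\<dots> = 4 * (real k)\<^sup>2 * (\<bar>\<phi>2\<bar> * (D * D))"
      by (simp only: D(2)) (simp add: algebra_simps)
    also have "\<dots> \<le> 4 * (real k)\<^sup>2 * (12 * \<gamma>)"
      using b2 by (intro mult_left_mono) auto
    finally show ?thesis by simp
  qed
  define e where "e = (if i = j then 1 else 0) - 1 / real k"
  have t2: "\<bar>\<phi>1 * (2 * e) * R\<bar> \<le> 24 * (real k)\<^sup>2 * \<gamma>"
  proof -
    have "\<bar>e\<bar> \<le> 1"
      using assms(1) by (auto simp: e_def)
    then have "\<bar>\<phi>1\<bar> * (\<bar>e\<bar> * \<bar>R\<bar>) \<le> \<bar>\<phi>1\<bar> * (1 * ((real k)\<^sup>2 * D))"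
      using R by (intro mult_left_mono mult_mono) auto
    also have "\<dots> = (real k)\<^sup>2 * (\<bar>\<phi>1\<bar> * D)"
      by simp
    also have "\<dots> \<le> (real k)\<^sup>2 * (12 * \<gamma>)"
      using b1 by (intro mult_left_mono) auto
    finally show ?thesis by (simp only: abs_mult)
  qed
  have t3: "\<bar>\<phi>1 * (2 * (v l - mean k v)) * gap' k l' v\<bar> \<le> 24 * (real k)\<^sup>2 * \<gamma>" if "l < k" "l' < k" for l l'
  proof -
    have "\<bar>\<phi>1\<bar> * (\<bar>v l - mean k v\<bar> * \<bar>gap' k l' v\<bar>) \<le> \<bar>\<phi>1\<bar> * (s * (real k * s))"
      using dev[OF that(1)] R'[OF that(2)] D by (intro mult_left_mono mult_mono) auto
    also have "\<dots> = real k * (\<bar>\<phi>1\<bar> * D)"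
      by (simp add: D(2)[symmetric])
    also have "\<dots> \<le> (real k)\<^sup>2 * (12 * \<gamma>)"
      by (rule mult_mono[OF kk(1) b1]) (use D in auto)
    finally show ?thesis by (simp only: abs_mult)
  qed
  define \<phi> where "\<phi> = ramp \<gamma> \<delta> D"
  define M where "M = real (k - 1) / real k * mean k v ^ (k - 2)"
  have \<phi>: "0 \<le> \<phi>" "\<phi> \<le> 1"
    by (auto simp: \<phi>_def ramp_bounds)
  have M: "M \<ge> 0"
    unfolding M_def using mean_bounds[of k v] v by auto
  have "\<phi> * gap'' k i j v \<le> \<phi> * M"
    using \<phi> v unfolding gap''_def M_def
    by (intro mult_left_mono) (auto intro!: prod_nonneg)
  also have "\<dots> \<le> 1 * M"
    using \<phi> M by (intro mult_right_mono) auto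
  finally have t4: "0 \<le> M - \<phi> * gap'' k i j v" by simp
  \<comment> \<open>The four perturbation terms add up to 48 + 24 + 24 + 24 = 120.\<close>
  show ?thesis
    using t1 t2 t3[OF assms(2,3)] t3[OF assms(3,2)] t4
    unfolding blend''_def D_def[symmetric] R_def[symmetric] \<phi>1_def[symmetric] \<phi>2_def[symmetric]
      \<phi>_def[symmetric] M_def[symmetric] e_def[symmetric]
    by linarith
qed

text \<open>The mean value theorem is applied once in each direction. The updates are nested so that
  for \<open>i = j\<close> the two shifts add up; this is the case of two items of the same
  class.\<close>

lemma mixed_difference_ge:
  fixes F :: "(nat \<Rightarrow> real) \<Rightarrow> real"
  assumes "0 < h"
    and d1: "\<And>v l x. l < k \<Longrightarrow> ((\<lambda>x. F (v(l := x))) has_real_derivative F1 l (v(l := x))) (at x)"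
    and d2: "\<And>v l l' x. l < k \<Longrightarrow> l' < k \<Longrightarrow>
        ((\<lambda>x. F1 l (v(l' := x))) has_real_derivative F2 l l' (v(l' := x))) (at x)"
    and ij: "i < k" "j < k"
    and ge: "\<And>s t. 0 \<le> s \<Longrightarrow> s \<le> h \<Longrightarrow> 0 \<le> t \<Longrightarrow> t \<le> h \<Longrightarrow>
        - C \<le> F2 i j (z(i := z i + s, j := (z(i := z i + s)) j + t))"
  shows "- C * h\<^sup>2 \<le> F (z(i := z i + h, j := (z(i := z i + h)) j + h)) - F (z(i := z i + h)) - F (z(j := z j + h)) + F z"
proof -
  define p where "p s t = z(i := z i + s, j := (z(i := z i + s)) j + t)" for s t
  \<comment> \<open>The two shifts commute, so \<open>p\<close> can be differentiated in either
    parameter.\<close>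
  have p': "p s t = (z(j := z j + t))(i := (z(j := z j + t)) i + s)" for s t
    by (auto simp: p_def fun_eq_iff)
  have 1: "((\<lambda>s. F (p s t)) has_real_derivative F1 i (p s t)) (at s)" for s t
    unfolding p' using d1[OF ij(1), of "z(j := z j + t)" "s + (z(j := z j + t)) i"]
    by (subst (asm) DERIV_shift) (simp add: add.commute)
  have 2: "((\<lambda>t. F1 i (p s t)) has_real_derivative F2 i j (p s t)) (at t)" for s t
    unfolding p_def using d2[OF ij, of "z(i := z i + s)" "t + (z(i := z i + s)) j"]
    by (subst (asm) DERIV_shift) (simp add: add.commute)
  have 3: "((\<lambda>s. F (p s h) - F (p s 0)) has_real_derivative F1 i (p s h) - F1 i (p s 0)) (at s)" for s
    by (intro DERIV_diff 1)
  obtain s where s: "0 < s" "s < h"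
    "(F (p h h) - F (p h 0)) - (F (p 0 h) - F (p 0 0)) = h * (F1 i (p s h) - F1 i (p s 0))"
    using MVT2[OF assms(1) 3] by auto
  obtain t where t: "0 < t" "t < h" "F1 i (p s h) - F1 i (p s 0) = h * F2 i j (p s t)"
    using MVT2[OF assms(1) 2] by auto
  have "- C \<le> F2 i j (p s t)"
    using ge[of s t] s t by (simp add: p_def)
  then have "h\<^sup>2 * (- C) \<le> h\<^sup>2 * F2 i j (p s t)"
    by (intro mult_left_mono) auto
  also have "\<dots> = (F (p h h) - F (p h 0)) - (F (p 0 h) - F (p 0 0))"
    using s(3) t(3) by (simp add: power2_eq_square)
  finally have "- C * h\<^sup>2 \<le> F (p h h) - F (p h 0) - F (p 0 h) + F (p 0 0)"
    by (simp add: mult.commute)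
  moreover have "p h 0 = z(i := z i + h)" "p 0 h = z(j := z j + h)" "p 0 0 = z"
    by (auto simp: p_def fun_eq_iff)
  ultimately show ?thesis
    unfolding p_def by simp
qed

lemma blend_mixed_difference_ge:
  assumes "2 \<le> k" "i < k" "j < k" "0 < \<delta>" "0 \<le> \<gamma>" "\<gamma> \<le> 1" "0 < h"
    and v: "\<And>l. l < k \<Longrightarrow> 0 \<le> z l \<and> (z(i := z i + h, j := (z(i := z i + h)) j + h)) l \<le> 1"
  shows "- (120 * (real k)\<^sup>2 * \<gamma>) * h\<^sup>2 \<le> blend k \<gamma> \<delta> (z(i := z i + h, j := (z(i := z i + h)) j + h))
      - blend k \<gamma> \<delta> (z(i := z i + h)) - blend k \<gamma> \<delta> (z(j := z j + h)) + blend k \<gamma> \<delta> z"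
proof (rule mixed_difference_ge[where k = k])
  show "0 < h" "i < k" "j < k" by fact+
  show "((\<lambda>x. blend k \<gamma> \<delta> (v(l := x))) has_real_derivative blend' k \<gamma> \<delta> l (v(l := x))) (at x)"
    if "l < k" for v l x
    by (rule has_real_derivative_blend[OF that assms(4)])
  show "((\<lambda>x. blend' k \<gamma> \<delta> l (v(l' := x))) has_real_derivative blend'' k \<gamma> \<delta> l l' (v(l' := x))) (at x)"
    if "l < k" "l' < k" for v l l' x
    by (rule has_real_derivative_blend'[OF that(2,1) assms(4)])
  fix s t assume st: "0 \<le> s" "s \<le> h" "0 \<le> t" "t \<le> h"
  show "- (120 * (real k)\<^sup>2 * \<gamma>) \<le> blend'' k \<gamma> \<delta> i j (z(i := z i + s, j := (z(i := z i + s)) j + t))"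
  proof (rule blend''_ge)
    fix l assume "l < k"
    have "z l \<le> (z(i := z i + s, j := (z(i := z i + s)) j + t)) l"
      "(z(i := z i + s, j := (z(i := z i + s)) j + t)) l \<le> (z(i := z i + h, j := (z(i := z i + h)) j + h)) l"
      using st by (simp_all add: fun_upd_def)
    then show "0 \<le> (z(i := z i + s, j := (z(i := z i + s)) j + t)) l \<and>
        (z(i := z i + s, j := (z(i := z i + s)) j + t)) l \<le> 1"
      using v[OF \<open>l < k\<close>] by linarith
  qed fact+
qed

section \<open>Utilities with a hidden partition\<close>

text \<open>The inequality of arithmetic and geometric means, from
  \<open>x \<le> exp (x - 1)\<close> at \<open>x = v l / m\<close>: the exponents sum to
  zero.\<close>

lemma prod_le_mean_power:
  assumes "0 < k" "\<And>l. l < k \<Longrightarrow> 0 \<le> v l"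
  shows "(\<Prod>l<k. v l) \<le> mean k v ^ k"
proof -
  define m where "m = mean k v"
  have sum: "(\<Sum>l<k. v l) = real k * m"
    using assms(1) by (simp add: m_def mean_def)
  have "m \<ge> 0"
    unfolding m_def mean_def using assms by (auto intro!: divide_nonneg_nonneg sum_nonneg)
  then consider "m = 0" | "m > 0" by linarith
  then show ?thesis
  proof cases
    case 1
    then have "v 0 = 0"
      using sum assms sum_nonneg_eq_0_iff[of "{..<k}" v] by auto
    then have "(\<Prod>l<k. v l) = 0"
      using assms(1) by (intro prod_zero) auto
    then show ?thesis
      using \<open>m \<ge> 0\<close> by (simp del: prod_zero_iff flip: m_def)
  next
    case 2
    have "(\<Prod>l<k. v l / m) \<le> (\<Prod>l<k. exp (v l / m - 1))"
    proof (rule prod_mono)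
      fix l assume "l \<in> {..<k}"
      then show "0 \<le> v l / m \<and> v l / m \<le> exp (v l / m - 1)"
        using assms(2)[of l] 2 exp_ge_add_one_self[of "v l / m - 1"] by auto
    qed
    also have "\<dots> = exp (\<Sum>l<k. v l / m - 1)"
      by (simp add: exp_sum)
    also have "(\<Sum>l<k. v l / m - 1) = 0"
      using 2 by (simp add: sum_subtractf sum_divide_distrib[symmetric] sum)
    finally show ?thesis
      using 2 by (simp add: prod_dividef divide_le_eq flip: m_def)
  qed
qed

lemma gap_nonneg:
  assumes "0 < k" "\<And>l. l < k \<Longrightarrow> 0 \<le> v l"
  shows "0 \<le> gap k v"
  unfolding gap_def using prod_le_mean_power[of k v] assms by auto

text \<open>Exchange of two single elements gives decreasing marginals when a set is enlarged one
  element at a time; adding the elements of \<open>B - A\<close> one at a time then yields the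
  inequality for arbitrary sets.\<close>

lemma submodular_on_localI:
  fixes f :: "'a set \<Rightarrow> real"
  assumes "finite N"
    and local: "\<And>S a b. S \<subseteq> N \<Longrightarrow> a \<in> N - S \<Longrightarrow> b \<in> N - S \<Longrightarrow> a \<noteq> b \<Longrightarrow>
      f (insert a (insert b S)) + f S \<le> f (insert a S) + f (insert b S)"
  shows "submodular_on N f"
proof -
  have marginal: "f (insert a (S \<union> X)) - f (S \<union> X) \<le> f (insert a S) - f S"
    if "finite X" "X \<subseteq> N" "S \<subseteq> N" "a \<in> N" "a \<notin> S \<union> X" "S \<inter> X = {}" for S X a
    using that
  proof (induction X rule: finite_induct)
    case (insert b X)
    have "f (insert a (insert b (S \<union> X))) + f (S \<union> X) \<le> f (insert a (S \<union> X)) + f (insert b (S \<union> X))"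
      using insert.prems insert.hyps by (intro local) auto
    moreover have "f (insert a (S \<union> X)) - f (S \<union> X) \<le> f (insert a S) - f S"
      using insert.prems by (intro insert.IH) auto
    ultimately show ?case
      by simp
  qed simp
  have diff: "f (A \<union> Y) - f A \<le> f (S \<union> Y) - f S" if "finite Y" "Y \<subseteq> N" "A \<subseteq> N" "S \<subseteq> A" "A \<inter> Y = {}" for A S Y
    using that
  proof (induction Y rule: finite_induct)
    case (insert b Y)
    have fin: "finite (A - S)"
      using insert.prems assms(1) by (auto intro: finite_subset)
    have "f (insert b ((S \<union> Y) \<union> (A - S))) - f ((S \<union> Y) \<union> (A - S)) \<le> f (insert b (S \<union> Y)) - f (S \<union> Y)"
      using insert.prems insert.hyps by (intro marginal fin) auto
    moreover have "(S \<union> Y) \<union> (A - S) = A \<union> Y"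
      using insert.prems by auto
    moreover have "f (A \<union> Y) - f A \<le> f (S \<union> Y) - f S"
      using insert.prems by (intro insert.IH) auto
    ultimately show ?case
      by simp
  qed simp
  show ?thesis
    unfolding submodular_on_def
  proof (intro allI impI)
    fix A B assume AB: "A \<subseteq> N" "B \<subseteq> N"
    have "f (A \<union> (B - A)) - f A \<le> f ((A \<inter> B) \<union> (B - A)) - f (A \<inter> B)"
      using AB assms(1) by (intro diff) (auto intro: finite_subset)
    moreover have "A \<union> (B - A) = A \<union> B" "(A \<inter> B) \<union> (B - A) = B"
      by auto
    ultimately show "f (A \<union> B) + f (A \<inter> B) \<le> f A + f B"
      by simp
  qed
qed

section \<open>The plain and the hidden utility function\<close>

definition left_over :: "nat \<Rightarrow> nat set \<Rightarrow> real" where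
  "left_over n S = real (card ({..<n} - S)) / real n"

text \<open>Counts are divided by \<open>n\<close> and not by the class size, so they sum to
  \<open>left_over\<close> and each item shifts one coordinate by exactly \<open>1 / n\<close>. For
  classes of size n / k the uncovered fraction is \<open>k\<close> times this value, whence the
  factor \<open>real k ^ k\<close> in front of \<open>blend\<close>.\<close>

definition class_left_over :: "nat \<Rightarrow> (nat \<Rightarrow> nat) \<Rightarrow> nat set \<Rightarrow> nat \<Rightarrow> real" where
  "class_left_over n g S l = real (card {y \<in> {..<n} - S. g y = l}) / real n"

text \<open>The last summand is the concave repair term; its constant 1 keeps it
  non-negative.\<close>

definition plain_utility :: "nat \<Rightarrow> real \<Rightarrow> nat \<Rightarrow> nat set \<Rightarrow> real" where
  "plain_utility k \<eta> n S =
     real k / real (k - 1) * (left_over n S - left_over n S ^ k) + \<eta> * (1 - (left_over n S)\<^sup>2)"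

definition hidden_utility :: "nat \<Rightarrow> real \<Rightarrow> real \<Rightarrow> real \<Rightarrow> nat \<Rightarrow> (nat \<Rightarrow> nat) \<Rightarrow> nat set \<Rightarrow> real" where
  "hidden_utility k \<gamma> \<delta> \<eta> n g S =
     real k / real (k - 1) * (left_over n S - real k ^ k * blend k \<gamma> \<delta> (class_left_over n g S))
     + \<eta> * (1 - (left_over n S)\<^sup>2)"

lemma left_over_bounds: "0 \<le> left_over n S" "left_over n S \<le> 1"
proof -
  have "card ({..<n} - S) \<le> card {..<n}"
    by (intro card_mono) auto
  then show "0 \<le> left_over n S" "left_over n S \<le> 1"
    by (auto simp: left_over_def divide_le_eq)
qed

lemma class_left_over_bounds: "0 \<le> class_left_over n g S l" "class_left_over n g S l \<le> 1"
proof -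
  have "card {y \<in> {..<n} - S. g y = l} \<le> card {..<n}"
    by (intro card_mono) auto
  then show "0 \<le> class_left_over n g S l" "class_left_over n g S l \<le> 1"
    by (auto simp: class_left_over_def divide_le_eq)
qed

lemma sum_class_left_over:
  assumes "g ` {..<n} \<subseteq> {..<k}"
  shows "(\<Sum>l<k. class_left_over n g S l) = left_over n S"
proof -
  have "g ` ({..<n} - S) \<subseteq> {..<k}"
    using assms by auto
  then have "card ({..<n} - S) = (\<Sum>l<k. card {y \<in> {..<n} - S. g y = l})"
    using sum.group[of "{..<n} - S" "{..<k}" g "\<lambda>_. 1 :: nat"] by simp
  then show ?thesis
    by (simp add: class_left_over_def left_over_def sum_divide_distrib)
qed

lemma mean_class_left_over:
  assumes "g ` {..<n} \<subseteq> {..<k}"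
  shows "mean k (class_left_over n g S) = left_over n S / real k"
  by (simp add: mean_def sum_class_left_over[OF assms])

lemma scaled_mean_power:
  assumes "g ` {..<n} \<subseteq> {..<k}" "k > 0"
  shows "real k ^ k * mean k (class_left_over n g S) ^ k = left_over n S ^ k"
  using assms(2) by (simp add: mean_class_left_over[OF assms(1)] power_divide)

lemma blend_bounds:
  assumes "k > 0" "\<And>l. l < k \<Longrightarrow> 0 \<le> v l"
  shows "0 \<le> blend k \<gamma> \<delta> v" "blend k \<gamma> \<delta> v \<le> mean k v ^ k"
proof -
  have g: "0 \<le> gap k v"
    using assms by (rule gap_nonneg)
  have "ramp \<gamma> \<delta> (dispersion k v) * gap k v \<le> 1 * gap k v"
    using g ramp_bounds by (intro mult_right_mono) auto
  moreover have "gap k v \<le> mean k v ^ k"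
    using assms by (auto simp: gap_def intro!: prod_nonneg)
  ultimately show "0 \<le> blend k \<gamma> \<delta> v"
    by (simp add: blend_def)
  show "blend k \<gamma> \<delta> v \<le> mean k v ^ k"
    using g ramp_bounds by (simp add: blend_def)
qed

text \<open>The scaled blend lies between 0 and the \<open>k\<close>-th power of the left-over,
  hence below the left-over itself. The prefactor is at most 2, which gives 2 * 1 + 1 * 1 as upper
  bound.\<close>

lemma hidden_utility_bounds:
  assumes "2 \<le> k" "g ` {..<n} \<subseteq> {..<k}" "0 \<le> \<eta>" "\<eta> \<le> 1"
  shows "0 \<le> hidden_utility k \<gamma> \<delta> \<eta> n g S" "hidden_utility k \<gamma> \<delta> \<eta> n g S \<le> 3"
proof -
  let ?m = "left_over n S" and ?b = "blend k \<gamma> \<delta> (class_left_over n g S)"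
  have c: "0 \<le> real k / real (k - 1)" "real k / real (k - 1) \<le> 2"
    using assms(1) by (auto simp: divide_le_eq)
  have b: "0 \<le> real k ^ k * ?b"
    using blend_bounds(1)[of k "class_left_over n g S"] class_left_over_bounds assms(1) by simp
  have "real k ^ k * ?b \<le> real k ^ k * mean k (class_left_over n g S) ^ k"
    using class_left_over_bounds assms(1) by (intro mult_left_mono blend_bounds) auto
  also have "\<dots> = ?m ^ k"
    using assms by (intro scaled_mean_power) auto
  also have "\<dots> \<le> ?m"
    using power_decreasing[of 1 k ?m] left_over_bounds[of n S] assms(1) by simp
  finally have d: "0 \<le> ?m - real k ^ k * ?b" "?m - real k ^ k * ?b \<le> 1"
    using b left_over_bounds[of n S] by auto
  have e: "0 \<le> 1 - ?m\<^sup>2" "1 - ?m\<^sup>2 \<le> 1"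
    using left_over_bounds[of n S] by (auto simp: power_le_one)
  show "0 \<le> hidden_utility k \<gamma> \<delta> \<eta> n g S"
    unfolding hidden_utility_def using c d e assms by simp
  have A: "real k / real (k - 1) * (?m - real k ^ k * ?b) \<le> 2 * 1"
    using c d by (intro mult_mono) auto
  have B: "\<eta> * (1 - ?m\<^sup>2) \<le> 1 * 1"
    using e assms by (intro mult_mono) auto
  show "hidden_utility k \<gamma> \<delta> \<eta> n g S \<le> 3"
    unfolding hidden_utility_def by (rule order_trans[OF add_mono[OF A B]]) simp
qed

lemma left_over_insert:
  assumes "a < n" "a \<notin> S"
  shows "left_over n S = left_over n (insert a S) + 1 / real n"
proof -
  have "{..<n} - S = insert a ({..<n} - insert a S)"
    using assms by auto
  then have "card ({..<n} - S) = Suc (card ({..<n} - insert a S))"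
    by (metis Diff_iff card_insert_disjoint finite_Diff finite_lessThan insertI1)
  then show ?thesis
    by (simp add: left_over_def add_divide_distrib)
qed

lemma class_left_over_insert:
  assumes "a < n" "a \<notin> S"
  shows "class_left_over n g S = (class_left_over n g (insert a S))
    (g a := class_left_over n g (insert a S) (g a) + 1 / real n)"
proof
  fix l
  show "class_left_over n g S l = ((class_left_over n g (insert a S))
    (g a := class_left_over n g (insert a S) (g a) + 1 / real n)) l"
  proof (cases "l = g a")
    case True
    have "{y \<in> {..<n} - S. g y = l} = insert a {y \<in> {..<n} - insert a S. g y = l}"
      using assms True by auto
    then show ?thesis
      using True by (simp add: class_left_over_def add_divide_distrib)
  next
    case False
    then have "{y \<in> {..<n} - S. g y = l} = {y \<in> {..<n} - insert a S. g y = l}"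
      by auto
    then show ?thesis
      using False by (simp add: class_left_over_def)
  qed
qed

text \<open>Uncovering \<open>a\<close> and \<open>b\<close> moves along a grid of mesh
  \<open>h = 1 / n\<close>, starting where both are covered. The repair term contributes
  \<open>2 * \<eta> * h^2\<close> to the exchange inequality, and by the bound on
  \<open>\<gamma>\<close> the blend costs at most as much, since the prefactor is at most 2.\<close>

lemma submodular_hidden_utility:
  assumes "2 \<le> k" "g ` {..<n} \<subseteq> {..<k}" "0 < \<delta>" "0 \<le> \<gamma>" "\<gamma> \<le> 1"
    and \<gamma>: "120 * real k ^ k * (real k)\<^sup>2 * \<gamma> \<le> \<eta>"
  shows "submodular_on {..<n} (hidden_utility k \<gamma> \<delta> \<eta> n g)"
proof (rule submodular_on_localI)
  fix S a b assume ab: "S \<subseteq> {..<n}" "a \<in> {..<n} - S" "b \<in> {..<n} - S" "a \<noteq> b"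
  define h where "h = 1 / real n"
  define z where "z = class_left_over n g (insert a (insert b S))"
  define m where "m = left_over n (insert a (insert b S))"
  let ?B = "blend k \<gamma> \<delta>"
  have h: "h > 0"
    using ab by (auto simp: h_def)
  have i: "g a < k" "g b < k"
    using ab assms(2) by auto
  have zb: "class_left_over n g (insert b S) = z(g a := z (g a) + h)"
    unfolding z_def h_def using ab by (intro class_left_over_insert) auto
  have za: "class_left_over n g (insert a S) = z(g b := z (g b) + h)"
    unfolding z_def h_def insert_commute[of a b] using ab by (intro class_left_over_insert) auto
  have z0: "class_left_over n g S = z(g a := z (g a) + h, g b := (z(g a := z (g a) + h)) (g b) + h)"
    unfolding zb[symmetric] unfolding h_def using ab by (intro class_left_over_insert) auto
  have mb: "left_over n (insert b S) = m + h"
    unfolding m_def h_def using ab by (intro left_over_insert) auto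
  have ma: "left_over n (insert a S) = m + h"
    unfolding m_def h_def insert_commute[of a b] using ab by (intro left_over_insert) auto
  have m0: "left_over n S = m + h + h"
    unfolding mb[symmetric] unfolding h_def using ab by (intro left_over_insert) auto
  define \<Delta> where "\<Delta> = ?B (class_left_over n g S) - ?B (class_left_over n g (insert b S))
      - ?B (class_left_over n g (insert a S)) + ?B (class_left_over n g (insert a (insert b S)))"
  have "- (120 * (real k)\<^sup>2 * \<gamma>) * h\<^sup>2 \<le> \<Delta>"
    unfolding \<Delta>_def za zb z0 z_def[symmetric]
  proof (rule blend_mixed_difference_ge)
    show "0 \<le> z l \<and> (z(g a := z (g a) + h, g b := (z(g a := z (g a) + h)) (g b) + h)) l \<le> 1" for l
      unfolding z0[symmetric] by (auto simp: z_def class_left_over_bounds)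
  qed (use assms h i in auto)
  then have "real k ^ k * (- (120 * (real k)\<^sup>2 * \<gamma>) * h\<^sup>2) \<le> real k ^ k * \<Delta>"
    by (intro mult_left_mono) auto
  moreover have "120 * real k ^ k * (real k)\<^sup>2 * \<gamma> * h\<^sup>2 \<le> \<eta> * h\<^sup>2"
    using \<gamma> by (intro mult_right_mono) auto
  ultimately have D: "- (\<eta> * h\<^sup>2) \<le> real k ^ k * \<Delta>"
    by (simp add: algebra_simps)
  have c: "0 \<le> real k / real (k - 1)" "real k / real (k - 1) \<le> 2"
    using assms(1) by (auto simp: divide_le_eq)
  have "0 \<le> \<eta>"
    using \<gamma> assms(4) by (meson mult_nonneg_nonneg of_nat_0_le_iff order_trans zero_le_numeral zero_le_power zero_le_power2)
  then have "real k / real (k - 1) * (\<eta> * h\<^sup>2) \<le> 2 * (\<eta> * h\<^sup>2)"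
    using c by (intro mult_right_mono) auto
  moreover have "real k / real (k - 1) * - (\<eta> * h\<^sup>2) \<le> real k / real (k - 1) * (real k ^ k * \<Delta>)"
    using D c by (intro mult_left_mono) auto
  ultimately have "0 \<le> real k / real (k - 1) * (real k ^ k * \<Delta>) + 2 * (\<eta> * h\<^sup>2)"
    by simp
  also have "\<dots> = hidden_utility k \<gamma> \<delta> \<eta> n g (insert a S) + hidden_utility k \<gamma> \<delta> \<eta> n g (insert b S)
      - hidden_utility k \<gamma> \<delta> \<eta> n g (insert a (insert b S)) - hidden_utility k \<gamma> \<delta> \<eta> n g S"
    unfolding hidden_utility_def mb ma m0 m_def[symmetric] \<Delta>_def by algebra
  finally show "hidden_utility k \<gamma> \<delta> \<eta> n g (insert a (insert b S)) + hidden_utility k \<gamma> \<delta> \<eta> n g S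
      \<le> hidden_utility k \<gamma> \<delta> \<eta> n g (insert a S) + hidden_utility k \<gamma> \<delta> \<eta> n g (insert b S)"
    by simp
qed simp

lemma utility_hidden_utility:
  assumes "2 \<le> k" "g ` {..<n} \<subseteq> {..<k}" "0 < \<delta>" "0 \<le> \<gamma>" "\<gamma> \<le> 1"
    and "120 * real k ^ k * (real k)\<^sup>2 * \<gamma> \<le> \<eta>" "0 \<le> \<eta>" "\<eta> \<le> 1"
  shows "utility_on {..<n} (hidden_utility k \<gamma> \<delta> \<eta> n g)"
  unfolding utility_on_def using submodular_hidden_utility hidden_utility_bounds assms by blast

lemma hidden_eq_plain:
  assumes "0 < k" "g ` {..<n} \<subseteq> {..<k}" "ramp \<gamma> \<delta> (dispersion k (class_left_over n g S)) = 0"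
  shows "hidden_utility k \<gamma> \<delta> \<eta> n g S = plain_utility k \<eta> n S"
  using assms by (simp add: hidden_utility_def plain_utility_def blend_def scaled_mean_power)

text \<open>For \<open>\<gamma> = 0\<close> the cut-off vanishes identically.\<close>

lemma plain_eq_hidden:
  assumes "0 < k"
  shows "plain_utility k \<eta> n = hidden_utility k 0 1 \<eta> n (\<lambda>_. 0)"
  using assms by (intro ext hidden_eq_plain[symmetric]) (auto simp: ramp_def decay_def)

lemma utility_plain_utility:
  assumes "2 \<le> k" "0 \<le> \<eta>" "\<eta> \<le> 1"
  shows "utility_on {..<n} (plain_utility k \<eta> n)"
proof -
  have "utility_on {..<n} (hidden_utility k 0 1 \<eta> n (\<lambda>_. 0))"
    using assms by (intro utility_hidden_utility) auto
  then show ?thesis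
    using assms plain_eq_hidden[of k \<eta> n] by simp
qed

text \<open>The left-overs of the bundles sum to \<open>k - 1\<close>, and by convexity the sum of
  their \<open>k\<close>-th powers is least when all equal \<open>1 - 1 / k\<close>. The repair
  terms add at most \<open>\<eta>\<close> per player.\<close>

lemma plain_welfare_le:
  assumes "2 \<le> k" "0 < n" "0 \<le> \<eta>" "allocation k {..<n} S"
  shows "welfare k (\<lambda>_. plain_utility k \<eta> n) S \<le> real k * (1 - (1 - 1 / real k) ^ (k - 1)) + real k * \<eta>"
proof -
  define t where "t = 1 - 1 / real k"
  have t: "0 < t" "real k * t = real (k - 1)"
    using assms(1) by (auto simp: t_def field_simps)
  have sub: "S p \<subseteq> {..<n}" if "p < k" for p
    using assms(4) that by (auto simp: allocation_def)
  have "card (\<Union>p<k. S p) = (\<Sum>p<k. card (S p))"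
    using assms(4) sub
    by (intro card_UN_disjoint) (auto simp: allocation_def disjoint_family_on_def intro: finite_subset)
  then have cards: "(\<Sum>p<k. card (S p)) = n"
    using assms(4) by (simp add: allocation_def)
  have "left_over n (S p) = 1 - real (card (S p)) / real n" if "p < k" for p
    using sub[OF that] assms(2) card_mono[OF _ sub[OF that]]
    by (simp add: left_over_def card_Diff_subset finite_subset[OF sub[OF that]]  diff_divide_distrib)
  then have "(\<Sum>p<k. left_over n (S p)) = (\<Sum>p<k. 1 - real (card (S p)) / real n)"
    by (intro sum.cong) auto
  also have "\<dots> = real k - real (\<Sum>p<k. card (S p)) / real n"
    by (simp add: sum_subtractf sum_divide_distrib)
  finally have M: "(\<Sum>p<k. left_over n (S p)) = real k - 1"
    using assms(2) by (simp add: cards)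
  \<comment> \<open>Tangent line of the power at the average \<open>t\<close> of the left-overs; its
    linear part cancels when summed over the players.\<close>
  have tangent: "t ^ k + real k * t ^ (k - 1) * (x - t) \<le> x ^ k" if "0 \<le> x" for x
  proof -
    have "1 + real k * (x / t - 1) \<le> (1 + (x / t - 1)) ^ k"
      using that t by (intro Bernoulli_inequality) auto
    then have "t ^ k * (1 + real k * (x / t - 1)) \<le> t ^ k * (x / t) ^ k"
      using t by (intro mult_left_mono) auto
    also have "t ^ k * (x / t) ^ k = x ^ k"
      using t by (simp add: power_divide)
    also have "t ^ k * (1 + real k * (x / t - 1)) = t ^ k + real k * t ^ (k - 1) * (x - t)"
      using t(1) assms(1) by (cases k) (auto simp: field_simps)
    finally show ?thesis .
  qed
  have "real k * t ^ k = (\<Sum>p<k. t ^ k + real k * t ^ (k - 1) * (left_over n (S p) - t))"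
    using t assms(1) by (simp add: sum.distrib sum_distrib_left[symmetric] sum_subtractf M)
  also have "\<dots> \<le> (\<Sum>p<k. left_over n (S p) ^ k)"
    by (intro sum_mono tangent left_over_bounds)
  finally have pow: "real k * t ^ k \<le> (\<Sum>p<k. left_over n (S p) ^ k)" .
  have "welfare k (\<lambda>_. plain_utility k \<eta> n) S =
     real k / real (k - 1) * ((\<Sum>p<k. left_over n (S p)) - (\<Sum>p<k. left_over n (S p) ^ k))
     + (\<Sum>p<k. \<eta> * (1 - (left_over n (S p))\<^sup>2))"
    by (simp only: welfare_def plain_utility_def sum.distrib right_diff_distrib sum_subtractf sum_distrib_left)
  also have "\<dots> \<le> real k / real (k - 1) * ((real k - 1) - real k * t ^ k) + (\<Sum>p<k. \<eta> * 1)"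
    unfolding M using pow assms(3) by (intro add_mono mult_left_mono sum_mono diff_left_mono) auto
  also have "real k / real (k - 1) * ((real k - 1) - real k * t ^ k) = real k * (1 - t ^ (k - 1))"
  proof -
    have "real k * t ^ k = real (k - 1) * t ^ (k - 1)"
      using t(2) assms(1) by (cases k) auto
    then have "(real k - 1) - real k * t ^ k = real (k - 1) * (1 - t ^ (k - 1))"
      using assms(1) by (simp add: algebra_simps)
    then show ?thesis
      using assms(1) by simp
  qed
  finally show ?thesis
    by (simp add: t_def)
qed

text \<open>The hidden classes themselves serve as bundles. Bundle \<open>i\<close> exhausts its own
  class, so the product vanishes, while what is left of the other classes forces a large dispersion,
  where the ramp is almost 1.\<close>

lemma hidden_opt_ge:
  assumes k: "2 \<le> k" and g: "g ` {..<n} \<subseteq> {..<k}" and n: "0 < n" and \<delta>: "0 < \<delta>" "\<delta> \<le> 1 / 16"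
    and \<gamma>: "0 \<le> \<gamma>" and \<eta>: "0 \<le> \<eta>"
    and bal: "dispersion k (class_left_over n g {}) \<le> \<delta>"
    and q: "exp (\<gamma> * ln (32 * (real k)\<^sup>2 * \<delta>)) \<le> q"
  shows "real k - 6 * real k * q \<le> opt_welfare k {..<n} (\<lambda>_. hidden_utility k \<gamma> \<delta> \<eta> n g)"
proof -
  define T where "T i = {y \<in> {..<n}. g y = i}" for i
  define M where "M i = left_over n (T i)" for i
  have alloc: "allocation k {..<n} T"
    using g by (auto simp: allocation_def disjoint_family_on_def T_def)
  have c: "0 \<le> real k / real (k - 1)" "real k / real (k - 1) \<le> 2"
    using k by (auto simp: divide_le_eq)
  have q0: "0 \<le> q"
    using q by (meson exp_ge_zero order_trans)
  have M: "M i = 1 - class_left_over n g {} i" for i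
  proof -
    have "card ({..<n} - T i) = card {..<n} - card (T i)"
      by (intro card_Diff_subset) (auto simp: T_def)
    moreover have "card (T i) \<le> card {..<n}"
      by (intro card_mono) (auto simp: T_def)
    ultimately show ?thesis
      using n by (simp add: M_def left_over_def class_left_over_def T_def diff_divide_distrib)
  qed
  have total: "(\<Sum>i<k. class_left_over n g {} i) = 1"
    using n by (simp add: sum_class_left_over[OF g] left_over_def)
  have M_sum: "(\<Sum>i<k. M i) = real k - 1"
    by (simp add: M sum_subtractf total)
  have block: "real k / real (k - 1) * (M i - 3 * q) \<le> hidden_utility k \<gamma> \<delta> \<eta> n g (T i)" if "i < k" for i
  proof -
    define v where "v = class_left_over n g (T i)"
    have "class_left_over n g {} i - 1 / real k \<le> sqrt (dispersion k (class_left_over n g {}))"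
      using abs_deviation_le[OF that, of "class_left_over n g {}"] by (simp add: mean_def total)
    also have "\<dots> \<le> sqrt (1 / 16)"
      using bal \<delta> by simp
    also have "sqrt (1 / 16) = 1 / (4 :: real)"
      by (simp add: real_sqrt_divide)
    finally have "class_left_over n g {} i \<le> 1 / real k + 1 / 4"
      by simp
    \<comment> \<open>As there are at least two classes, none holds more than three quarters of the
      items, so a quarter is left over.\<close>
    also have "\<dots> \<le> 1 / 2 + 1 / 4"
      using k by (intro add_mono) (auto simp: field_simps)
    finally have Mi: "1 / 4 \<le> M i" "M i \<le> 1"
      using class_left_over_bounds(1)[of n g "{}" i] by (auto simp: M)
    have "{y \<in> {..<n} - T i. g y = i} = {}"
      by (auto simp: T_def)
    then have vi: "v i = 0"
      by (simp add: v_def class_left_over_def)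
    have mean: "mean k v = M i / real k"
      by (simp add: v_def mean_class_left_over[OF g] M_def)
    have "1 / (4 * real k) \<le> mean k v"
      using Mi k by (simp add: mean field_simps)
    also have "\<dots> \<le> sqrt (dispersion k v)"
      using abs_deviation_le[OF that, of v] vi by simp
    finally have "(1 / (4 * real k))\<^sup>2 \<le> (sqrt (dispersion k v))\<^sup>2"
      using k by (intro power_mono) auto
    then have D: "1 / (16 * (real k)\<^sup>2) \<le> dispersion k v"
      by (simp add: power_divide power_mult_distrib dispersion_nonneg)
    \<comment> \<open>The argument \<open>32 * (real k)\<^sup>2 * \<delta>\<close> is the quotient
      of \<open>2 * \<delta>\<close> from \<open>decay\<close> and the lower bound on the
      dispersion.\<close>
    have "ln (1 / (16 * (real k)\<^sup>2)) \<le> ln (dispersion k v + \<delta>)"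
      using D \<delta> k by (subst ln_le_cancel_iff) (auto intro: add_nonneg_pos simp: dispersion_nonneg)
    moreover have "ln (32 * (real k)\<^sup>2 * \<delta>) = ln (2 * \<delta>) - ln (1 / (16 * (real k)\<^sup>2))"
      using \<delta> k ln_div[of "2 * \<delta>" "1 / (16 * (real k)\<^sup>2)"] by (simp add: mult_ac)
    ultimately have "decay \<gamma> \<delta> (dispersion k v) \<le> exp (\<gamma> * ln (32 * (real k)\<^sup>2 * \<delta>))"
      unfolding decay_def using \<gamma> by (auto intro!: mult_left_mono)
    then have ramp: "1 - ramp \<gamma> \<delta> (dispersion k v) \<le> 3 * q"
      using ramp_ge[of \<gamma> \<delta> "dispersion k v"] q by linarith
    have "(\<Prod>l<k. v l) = 0"
      using vi that by (intro prod_zero) auto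
    then have "blend k \<gamma> \<delta> v = (1 - ramp \<gamma> \<delta> (dispersion k v)) * mean k v ^ k"
      by (simp only: blend_def gap_def) (simp add: algebra_simps)
    then have "real k ^ k * blend k \<gamma> \<delta> v = (1 - ramp \<gamma> \<delta> (dispersion k v)) * M i ^ k"
      using scaled_mean_power[OF g, of "T i"] k by (simp add: v_def M_def mult.left_commute)
    also have "\<dots> \<le> 3 * q * 1"
      using ramp q0 Mi by (intro mult_mono power_le_one) auto
    finally have "real k / real (k - 1) * (M i - 3 * q) \<le> real k / real (k - 1) * (M i - real k ^ k * blend k \<gamma> \<delta> v)"
      using c by (intro mult_left_mono) auto
    also have "\<dots> \<le> hidden_utility k \<gamma> \<delta> \<eta> n g (T i)"
      using \<eta> left_over_bounds[of n "T i"]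
      by (simp add: hidden_utility_def v_def M_def power_le_one)
    finally show ?thesis .
  qed
  \<comment> \<open>Each of the \<open>k\<close> bundles loses \<open>3 * q\<close> times a
    prefactor of at most 2.\<close>
  have "real k / real (k - 1) * (3 * q * real k) \<le> 2 * (3 * q * real k)"
    using c q0 by (intro mult_right_mono) auto
  then have "real k - 6 * real k * q \<le> real k - real k / real (k - 1) * (3 * q * real k)"
    by (simp add: mult_ac)
  also have "\<dots> = real k / real (k - 1) * ((real k - 1) - 3 * q * real k)"
  proof -
    have "real k / real (k - 1) * (real k - 1) = real k"
      using k by (simp add: field_simps)
    then show ?thesis
      by (simp only: right_diff_distrib)
  qed
  also have "\<dots> = (\<Sum>i<k. real k / real (k - 1) * (M i - 3 * q))"
    by (simp only: sum_distrib_left[symmetric] sum_subtractf M_sum) simp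
  also have "\<dots> \<le> welfare k (\<lambda>_. hidden_utility k \<gamma> \<delta> \<eta> n g) T"
    unfolding welfare_def by (intro sum_mono block) auto
  also have "\<dots> \<le> opt_welfare k {..<n} (\<lambda>_. hidden_utility k \<gamma> \<delta> \<eta> n g)"
    using alloc by (intro welfare_le_opt) auto
  finally show ?thesis .
qed

section \<open>Random colorings and concentration of class sizes\<close>

abbreviation random_coloring :: "nat \<Rightarrow> nat \<Rightarrow> (nat \<Rightarrow> nat) pmf" where
  "random_coloring k n \<equiv> Pi_pmf {..<n} 0 (\<lambda>_. pmf_of_set {0..k - 1})"

lemma map_pmf_uniform_eq_bernoulli:
  assumes "l < k"
  shows "map_pmf (\<lambda>a. a = l) (pmf_of_set {0..k - 1}) = bernoulli_pmf (1 / real k)"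
proof (rule pmf_eqI)
  fix b
  have *: "pmf (map_pmf (\<lambda>a. a = l) (pmf_of_set {0..k - 1})) True = 1 / real k"
  proof -
    have "{0..k - 1} \<inter> (\<lambda>a. a = l) -` {True} = {l}"
      using assms by auto
    then show ?thesis
      using assms by (simp add: pmf_map measure_pmf_of_set)
  qed
  show "pmf (map_pmf (\<lambda>a. a = l) (pmf_of_set {0..k - 1})) b = pmf (bernoulli_pmf (1 / real k)) b"
    using assms * by (cases b) (auto simp: pmf_False_conv_True)
qed

lemma class_size_binomial:
  assumes "l < k" "U \<subseteq> {..<n}"
  shows "map_pmf (\<lambda>g. card {y \<in> U. g y = l}) (random_coloring k n) = binomial_pmf (card U) (1 / real k)"
proof -
  have fin: "finite U"
    using assms(2) by (rule finite_subset) simp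
  \<comment> \<open>The default \<open>0 = l\<close> is the image of the default color 0 under
    comparison with \<open>l\<close>, so the comparison can be pulled out of the product.\<close>
  have "binomial_pmf (card U) (1 / real k) =
      map_pmf (\<lambda>f. card {x \<in> U. f x}) (Pi_pmf U (0 = l) (\<lambda>_. map_pmf (\<lambda>a. a = l) (pmf_of_set {0..k - 1})))"
    unfolding map_pmf_uniform_eq_bernoulli[OF assms(1)]
    using assms fin by (intro binomial_pmf_altdef') auto
  also have "\<dots> = map_pmf (\<lambda>g. card {x \<in> U. g x = l}) (Pi_pmf U 0 (\<lambda>_. pmf_of_set {0..k - 1}))"
    by (subst Pi_pmf_map[OF fin]) (auto simp: pmf.map_comp o_def)
  also have "\<dots> = map_pmf (\<lambda>g. card {y \<in> U. g y = l}) (random_coloring k n)"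
    by (subst Pi_pmf_subset[OF _ assms(2)]) (auto simp: pmf.map_comp o_def intro!: map_pmf_cong arg_cong[where f = card])
  finally show ?thesis ..
qed

text \<open>Hoeffding's inequality with \<open>card U\<close> trials; since \<open>card U\<close> is
  at most \<open>n\<close>, the bound with \<open>n\<close> is weaker. Empty \<open>U\<close> is
  separate because the general bound divides by the number of trials.\<close>

lemma class_size_concentration:
  assumes "l < k" "U \<subseteq> {..<n}" "0 < \<tau>" "0 < n"
  shows "measure_pmf.prob (random_coloring k n) {g. \<tau> * real n \<le> \<bar>real (card {y \<in> U. g y = l}) - real (card U) / real k\<bar>}
    \<le> 2 * exp (- 2 * \<tau>\<^sup>2 * real n)"
proof -
  define u where "u = card U"
  have u: "u \<le> n"
    using card_mono[OF _ assms(2)] by (simp add: u_def)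
  have "measure_pmf.prob (random_coloring k n) {g. \<tau> * real n \<le> \<bar>real (card {y \<in> U. g y = l}) - real (card U) / real k\<bar>} =
     measure_pmf.prob (map_pmf (\<lambda>g. card {y \<in> U. g y = l}) (random_coloring k n)) {x. \<tau> * real n \<le> \<bar>real x - real u * (1 / real k)\<bar>}"
    by (simp add: vimage_def u_def)
  also have "\<dots> = measure_pmf.prob (binomial_pmf u (1 / real k)) {x. \<tau> * real n \<le> \<bar>real x - real u * (1 / real k)\<bar>}"
    by (simp only: class_size_binomial[OF assms(1,2)] u_def)
  also have "\<dots> \<le> 2 * exp (- 2 * \<tau>\<^sup>2 * real n)"
  proof (cases "u = 0")
    case True
    have "\<not> \<tau> * real n \<le> 0"
      using assms by (simp add: not_le)
    moreover have "binomial_pmf 0 (1 / real k) = return_pmf 0"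
      using assms by (intro binomial_pmf_0) auto
    ultimately show ?thesis
      using True by simp
  next
    case False
    interpret binomial_distribution u "1 / real k"
      using assms by unfold_locales auto
    have "measure_pmf.prob (binomial_pmf u (1 / real k)) {x. \<tau> * real n \<le> \<bar>real x - real u * (1 / real k)\<bar>}
        \<le> 2 * exp (- 2 * (\<tau> * real n)\<^sup>2 / real u)"
      using False assms by (intro prob_abs_ge) auto
    also have "\<dots> \<le> 2 * exp (- 2 * \<tau>\<^sup>2 * real n)"
    proof -
      have "\<tau>\<^sup>2 * real n * real u \<le> \<tau>\<^sup>2 * real n * real n"
        using u by (intro mult_left_mono) auto
      then show ?thesis
        using False by (simp add: field_simps power2_eq_square)
    qed
    finally show ?thesis .
  qed
  finally show ?thesis .
qed

lemma set_random_coloring: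
  assumes "g \<in> set_pmf (random_coloring k n)" "0 < k"
  shows "g ` {..<n} \<subseteq> {..<k}"
proof -
  have "set_pmf (random_coloring k n) \<subseteq> PiE_dflt {..<n} 0 (\<lambda>_. {0..k - 1})"
    by (intro order_trans[OF set_Pi_pmf_subset']) auto
  then show ?thesis
    using assms by (fastforce simp: PiE_dflt_def)
qed

text \<open>If every class is within \<open>\<tau> * n\<close> of its share, the \<open>k\<close>
  squared deviations add up to at most \<open>\<delta>\<close>. A union bound over the classes
  finishes the argument.\<close>

lemma unbalanced_probability:
  assumes "0 < k" "0 < n" "0 < \<tau>" "real k * \<tau>\<^sup>2 \<le> \<delta>"
  shows "measure_pmf.prob (random_coloring k n) {g. \<delta> < dispersion k (class_left_over n g S)}
    \<le> 2 * real k * exp (- 2 * \<tau>\<^sup>2 * real n)"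
proof -
  let ?U = "{..<n} - S"
  let ?B = "\<lambda>l. {g. \<tau> * real n \<le> \<bar>real (card {y \<in> ?U. g y = l}) - real (card ?U) / real k\<bar>}"
  have "g \<in> (\<Union>l<k. ?B l)" if g: "g \<in> set_pmf (random_coloring k n)"
    and D: "\<delta> < dispersion k (class_left_over n g S)" for g
  proof (rule ccontr)
    assume *: "g \<notin> (\<Union>l<k. ?B l)"
    have mean: "mean k (class_left_over n g S) = left_over n S / real k"
      using set_random_coloring[OF g assms(1)] by (rule mean_class_left_over)
    have "\<bar>class_left_over n g S l - mean k (class_left_over n g S)\<bar> \<le> \<tau>" if "l < k" for l
    proof -
      have "\<bar>real (card {y \<in> ?U. g y = l}) - real (card ?U) / real k\<bar> \<le> \<tau> * real n"
        using * that by force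
      then have "\<bar>real (card {y \<in> ?U. g y = l}) - real (card ?U) / real k\<bar> / real n \<le> \<tau>"
        using assms by (simp add: divide_le_eq)
      also have "\<bar>real (card {y \<in> ?U. g y = l}) - real (card ?U) / real k\<bar> / real n =
          \<bar>(real (card {y \<in> ?U. g y = l}) - real (card ?U) / real k) / real n\<bar>"
        by simp
      finally show ?thesis
        by (simp add: mean class_left_over_def left_over_def diff_divide_distrib mult.commute)
    qed
    then have "(class_left_over n g S l - mean k (class_left_over n g S))\<^sup>2 \<le> \<tau>\<^sup>2" if "l < k" for l
      using that assms(3) by (simp add: abs_le_square_iff[symmetric])
    then have "dispersion k (class_left_over n g S) \<le> real (card {..<k}) * \<tau>\<^sup>2"
      unfolding dispersion_def by (intro sum_bounded_above) auto
    then show False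
      using D assms(4) by simp
  qed
  then have "measure_pmf.prob (random_coloring k n) {g. \<delta> < dispersion k (class_left_over n g S)}
      \<le> measure_pmf.prob (random_coloring k n) (\<Union>l<k. ?B l)"
    by (intro measure_pmf.finite_measure_mono_AE AE_pmfI) auto
  also have "\<dots> \<le> (\<Sum>l<k. measure_pmf.prob (random_coloring k n) (?B l))"
    by (intro measure_pmf.finite_measure_subadditive_finite) auto
  also have "\<dots> \<le> (\<Sum>l<k. 2 * exp (- 2 * \<tau>\<^sup>2 * real n))"
    using assms by (intro sum_mono class_size_concentration) auto
  finally show ?thesis
    by simp
qed

section \<open>Indistinguishability\<close>

text \<open>\<open>run_on\<close> intersects each query with the ground set; these invariances
  identify its oracle with the utility itself.\<close>

lemma left_over_Int [simp]: "left_over n (S \<inter> {..<n}) = left_over n S"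
  by (simp add: left_over_def Diff_Int)

lemma class_left_over_Int [simp]: "class_left_over n g (S \<inter> {..<n}) = class_left_over n g S"
proof -
  have "{..<n} - S \<inter> {..<n} = {..<n} - S"
    by auto
  then show ?thesis
    by (simp only: class_left_over_def[abs_def])
qed

lemma hidden_utility_Int [simp]: "hidden_utility k \<gamma> \<delta> \<eta> n g (S \<inter> {..<n}) = hidden_utility k \<gamma> \<delta> \<eta> n g S"
  by (simp add: hidden_utility_def)

lemma plain_utility_Int [simp]: "plain_utility k \<eta> n (S \<inter> {..<n}) = plain_utility k \<eta> n S"
  by (simp add: plain_utility_def)

definition unbalanced :: "nat \<Rightarrow> real \<Rightarrow> nat \<Rightarrow> (nat \<Rightarrow> nat) \<Rightarrow> nat set \<Rightarrow> bool" where
  "unbalanced k \<delta> n g Q \<longleftrightarrow> \<delta> < dispersion k (class_left_over n g Q)"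

text \<open>The output bundles count as queries, and so does the empty set, which controls the class sizes.\<close>

definition detects :: "nat \<Rightarrow> real \<Rightarrow> nat \<Rightarrow> (nat \<Rightarrow> nat) \<Rightarrow> ((nat \<Rightarrow> nat set) \<times> nat set list) option \<Rightarrow> bool" where
  "detects k \<delta> n g x = (case x of None \<Rightarrow> True
    | Some (S, Qs) \<Rightarrow> \<exists>Q \<in> set ({} # map S [0..<k] @ Qs). unbalanced k \<delta> n g Q)"

text \<open>The execution does not depend on \<open>g\<close>, so the transcript may be drawn first.
  Each recorded set is then fixed and is unbalanced for a random \<open>g\<close> with exponentially
  small probability. \<open>Suc k\<close> counts the empty set and the output bundles.\<close>

lemma detection_probability:
  assumes "0 < k" "0 < n" "0 < \<tau>" "real k * \<tau>\<^sup>2 \<le> \<delta>"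
    and tr: "lossless_spmf (transcript orc a)"
  shows "(\<integral>\<^sup>+ g. emeasure (measure_pmf (transcript orc a)) {x. detects k \<delta> n g x} \<partial>measure_pmf (random_coloring k n))
    \<le> ennreal (2 * real k * exp (- 2 * \<tau>\<^sup>2 * real n)) *
       ((\<integral>\<^sup>+ (S, q, t). of_nat q \<partial>measure_spmf (run orc a)) + of_nat (Suc k))"
proof -
  let ?C = "random_coloring k n" and ?T = "transcript orc a"
  define \<beta> where "\<beta> = ennreal (2 * real k * exp (- 2 * \<tau>\<^sup>2 * real n))"
  have \<beta>: "emeasure (measure_pmf ?C) {g. unbalanced k \<delta> n g Q} \<le> \<beta>" for Q
    unfolding \<beta>_def unbalanced_def measure_pmf.emeasure_eq_measure
    using unbalanced_probability[OF assms(1-4)] by (intro ennreal_leI)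
  have list: "emeasure (measure_pmf ?C) {g. \<exists>Q\<in>set L. unbalanced k \<delta> n g Q} \<le> \<beta> * of_nat (length L)" for L
  proof (induction L)
    case (Cons Q L)
    have "{g. \<exists>Q\<in>set (Q # L). unbalanced k \<delta> n g Q} = {g. unbalanced k \<delta> n g Q} \<union> {g. \<exists>Q\<in>set L. unbalanced k \<delta> n g Q}"
      by auto
    then have "emeasure (measure_pmf ?C) {g. \<exists>Q\<in>set (Q # L). unbalanced k \<delta> n g Q} \<le>
        emeasure (measure_pmf ?C) {g. unbalanced k \<delta> n g Q} + emeasure (measure_pmf ?C) {g. \<exists>Q\<in>set L. unbalanced k \<delta> n g Q}"
      by (simp only:) (intro emeasure_subadditive, auto)
    also have "\<dots> \<le> \<beta> + \<beta> * of_nat (length L)"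
      by (intro add_mono \<beta> Cons.IH)
    finally show ?case
      by (simp add: distrib_left)
  qed simp
  have "(\<integral>\<^sup>+ g. emeasure (measure_pmf ?T) {x. detects k \<delta> n g x} \<partial>measure_pmf ?C)
     = (\<integral>\<^sup>+ g. \<integral>\<^sup>+ x. indicator {(g, x). detects k \<delta> n g x} (g, x) \<partial>measure_pmf ?T \<partial>measure_pmf ?C)"
    by (intro nn_integral_cong) (auto simp: nn_integral_indicator[symmetric] indicator_def intro!: nn_integral_cong simp del: nn_integral_indicator)
  also have "\<dots> = (\<integral>\<^sup>+ z. indicator {(g, x). detects k \<delta> n g x} z \<partial>measure_pmf (bind_pmf ?C (\<lambda>g. bind_pmf ?T (\<lambda>x. return_pmf (g, x)))))"
    by simp
  also have "bind_pmf ?C (\<lambda>g. bind_pmf ?T (\<lambda>x. return_pmf (g, x))) = bind_pmf ?T (\<lambda>x. bind_pmf ?C (\<lambda>g. return_pmf (g, x)))"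
    by (rule bind_commute_pmf)
  also have "(\<integral>\<^sup>+ z. indicator {(g, x). detects k \<delta> n g x} z \<partial>measure_pmf \<dots>) =
      (\<integral>\<^sup>+ x. emeasure (measure_pmf ?C) {g. detects k \<delta> n g x} \<partial>measure_pmf ?T)"
    by (simp, intro nn_integral_cong) (auto simp: nn_integral_indicator[symmetric] indicator_def intro!: nn_integral_cong simp del: nn_integral_indicator)
  also have "\<dots> \<le> (\<integral>\<^sup>+ x. (case x of None \<Rightarrow> 0 | Some (S, Qs) \<Rightarrow> \<beta> * (of_nat (length Qs) + of_nat (Suc k))) \<partial>measure_pmf ?T)"
  proof (intro nn_integral_mono_AE AE_pmfI)
    fix x assume "x \<in> set_pmf ?T"
    moreover have "None \<notin> set_pmf ?T"
      using tr by (simp add: lossless_iff_set_pmf_None)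
    ultimately obtain S Qs where x: "x = Some (S, Qs)"
      by (cases x) auto
    then show "emeasure (measure_pmf ?C) {g. detects k \<delta> n g x} \<le>
        (case x of None \<Rightarrow> 0 | Some (S, Qs) \<Rightarrow> \<beta> * (of_nat (length Qs) + of_nat (Suc k)))"
      using list[of "{} # map S [0..<k] @ Qs"] by (simp add: detects_def add_ac del: set_append)
  qed
  also have "\<dots> = (\<integral>\<^sup>+ (S, Qs). \<beta> * (of_nat (length Qs) + of_nat (Suc k)) \<partial>measure_spmf ?T)"
    by (simp only: nn_integral_measure_spmf_option)
  also have "\<dots> = (\<integral>\<^sup>+ (S, q). \<beta> * (of_nat q + of_nat (Suc k)) \<partial>measure_spmf (map_spmf (apsnd length) ?T))"
    by (simp add: case_prod_beta' o_def)
  also have "\<dots> = (\<integral>\<^sup>+ (S, q, t). \<beta> * (of_nat q + of_nat (Suc k)) \<partial>measure_spmf (run orc a))"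
    by (simp add: case_prod_beta' o_def flip: run_eq_transcript)
  also have "\<dots> = \<beta> * (\<integral>\<^sup>+ (S, q, t). of_nat q + of_nat (Suc k) \<partial>measure_spmf (run orc a))"
    by (simp add: case_prod_beta' nn_integral_cmult)
  also have "\<dots> = \<beta> * ((\<integral>\<^sup>+ (S, q, t). of_nat q \<partial>measure_spmf (run orc a)) + of_nat (Suc k) * emeasure (measure_spmf (run orc a)) UNIV)"
    by (simp add: case_prod_beta' nn_integral_add space_measure_spmf)
  also have "\<dots> \<le> \<beta> * ((\<integral>\<^sup>+ (S, q, t). of_nat q \<partial>measure_spmf (run orc a)) + of_nat (Suc k) * 1)"
    using measure_spmf.emeasure_space_le_1[of "run orc a"]
    by (intro mult_left_mono add_mono) (auto simp: space_measure_spmf)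
  finally show ?thesis
    by (simp add: \<beta>_def)
qed

lemma lossless_transcript: "lossless_spmf (run orc a) \<Longrightarrow> lossless_spmf (transcript orc a)"
  using arg_cong[OF run_eq_transcript, of lossless_spmf orc a] by simp

text \<open>Without detection the execution is the one on the plain utility, and its bundles have
  the same value under both utilities, so \<open>plain_welfare_le\<close> applies. Otherwise the
  welfare is at most \<open>3 * k\<close>, weighted by \<open>\<beta>\<close>.\<close>

lemma hidden_welfare_le:
  assumes "2 \<le> k" "0 < n" "g ` {..<n} \<subseteq> {..<k}" "0 < \<delta>" "0 \<le> \<gamma>" "0 \<le> \<eta>" "\<eta> \<le> 1"
    and alloc: "\<forall>(S, q, t) \<in> set_spmf (run_on A n (plain_utility k \<eta> n)). allocation k {..<n} S"
    and det: "emeasure (measure_pmf (transcript (plain_utility k \<eta> n) (A n))) {x. detects k \<delta> n g x} \<le> ennreal \<beta>" "0 \<le> \<beta>"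
  shows "(\<integral>(S, q, t). welfare k (\<lambda>_. hidden_utility k \<gamma> \<delta> \<eta> n g) S \<partial>measure_spmf (run_on A n (hidden_utility k \<gamma> \<delta> \<eta> n g)))
    \<le> real k * (1 - (1 - 1 / real k) ^ (k - 1)) + real k * \<eta> + 3 * real k * \<beta>"
proof -
  let ?h = "hidden_utility k \<gamma> \<delta> \<eta> n g" and ?p = "plain_utility k \<eta> n"
  let ?T = "transcript ?p (A n)"
  define G where "G = {Q. \<not> unbalanced k \<delta> n g Q}"
  define w where "w S = ennreal (welfare k (\<lambda>_. ?h) S)" for S
  define B where "B = real k * (1 - (1 - 1 / real k) ^ (k - 1)) + real k * \<eta>"
  have "(1 - 1 / real k) ^ (k - 1) \<le> 1"
    using assms(1) by (intro power_le_one) auto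
  then have B: "0 \<le> B"
    using assms by (simp add: B_def)
  have agree: "?p Q = ?h Q" if "Q \<in> G" for Q
    using that assms ramp_eq_0[OF assms(4) dispersion_nonneg _ assms(5)]
    by (intro hidden_eq_plain[symmetric]) (auto simp: G_def unbalanced_def)
  have wb: "0 \<le> welfare k (\<lambda>_. ?h) S" "welfare k (\<lambda>_. ?h) S \<le> 3 * real k" for S
  proof -
    show "0 \<le> welfare k (\<lambda>_. ?h) S"
      unfolding welfare_def using assms by (intro sum_nonneg hidden_utility_bounds) auto
    have "(\<Sum>i<k. ?h (S i)) \<le> real (card {..<k}) * 3"
      using assms by (intro sum_bounded_above hidden_utility_bounds) auto
    then show "welfare k (\<lambda>_. ?h) S \<le> 3 * real k"
      by (simp add: welfare_def)
  qed
  have "(\<integral>\<^sup>+ (S, q, t). w S \<partial>measure_spmf (run ?h (A n))) \<le>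
      (\<integral>\<^sup>+ x. (case x of None \<Rightarrow> ennreal (3 * real k) | Some (S, Qs) \<Rightarrow> if set Qs \<subseteq> G then w S else ennreal (3 * real k)) \<partial>measure_pmf ?T)"
    using agree wb by (intro nn_integral_run_le_transcript) (auto simp: w_def intro!: ennreal_leI)
  also have "\<dots> \<le> (\<integral>\<^sup>+ x. ennreal B + ennreal (3 * real k) * indicator {x. detects k \<delta> n g x} x \<partial>measure_pmf ?T)"
  proof (intro nn_integral_mono_AE AE_pmfI)
    fix x assume x: "x \<in> set_pmf ?T"
    show "(case x of None \<Rightarrow> ennreal (3 * real k) | Some (S, Qs) \<Rightarrow> if set Qs \<subseteq> G then w S else ennreal (3 * real k))
       \<le> ennreal B + ennreal (3 * real k) * indicator {x. detects k \<delta> n g x} x"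
    proof (cases "detects k \<delta> n g x")
      case True
      then show ?thesis
        using wb by (auto split: option.splits simp: w_def intro!: add_increasing ennreal_leI)
    next
      case False
      then obtain S Qs where xS: "x = Some (S, Qs)"
        by (cases x) (auto simp: detects_def)
      then have "(S, Qs) \<in> set_spmf ?T"
        using x by (simp add: in_set_spmf)
      \<comment> \<open>The outputs are known to be allocations for \<open>run\<close>, so the
        transcript is translated back into a run on the plain utility.\<close>
      then have "(S, length Qs) \<in> set_spmf (map_spmf (apsnd length) ?T)"
        by force
      then have "(S, length Qs) \<in> set_spmf (map_spmf (\<lambda>(S, q, t). (S, q)) (run ?p (A n)))"
        by (simp only: run_eq_transcript)
      then have S: "allocation k {..<n} S"
        using alloc by (auto simp: run_on_def)
      have "S i \<in> G" if "i < k" for i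
        using False that by (auto simp: xS detects_def G_def)
      then have "welfare k (\<lambda>_. ?h) S = welfare k (\<lambda>_. ?p) S"
        unfolding welfare_def using agree by (intro sum.cong) auto
      also have "\<dots> \<le> B"
        unfolding B_def using assms S by (intro plain_welfare_le) auto
      finally have "w S \<le> ennreal B"
        unfolding w_def by (rule ennreal_leI)
      moreover have "set Qs \<subseteq> G"
        using False by (auto simp: xS detects_def G_def)
      ultimately show ?thesis
        using False by (simp add: xS)
    qed
  qed
  also have "\<dots> = ennreal B + ennreal (3 * real k) * emeasure (measure_pmf ?T) {x. detects k \<delta> n g x}"
    by (simp add: nn_integral_add nn_integral_cmult)
  also have "\<dots> \<le> ennreal B + ennreal (3 * real k) * ennreal \<beta>"
    using det by (intro add_mono mult_left_mono) auto
  also have "\<dots> = ennreal (B + 3 * real k * \<beta>)"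
    using B det(2) by (simp add: ennreal_mult)
  finally have le: "(\<integral>\<^sup>+ (S, q, t). w S \<partial>measure_spmf (run ?h (A n))) \<le> ennreal (B + 3 * real k * \<beta>)" .
  have "(\<integral>(S, q, t). welfare k (\<lambda>_. ?h) S \<partial>measure_spmf (run ?h (A n))) =
      enn2real (\<integral>\<^sup>+ (S, q, t). w S \<partial>measure_spmf (run ?h (A n)))"
    by (subst integral_eq_nn_integral) (auto simp: w_def wb case_prod_beta')
  also have "\<dots> \<le> enn2real (ennreal (B + 3 * real k * \<beta>))"
    using le by (intro enn2real_mono) auto
  also have "\<dots> = B + 3 * real k * \<beta>"
    using B det(2) by (intro enn2real_ennreal add_nonneg_nonneg mult_nonneg_nonneg) auto
  finally show ?thesis
    by (simp add: run_on_def B_def)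
qed

text \<open>The instance that forces many queries is the plain utility. With few queries there,
  averaging yields a coloring whose hidden utility is served no better than the plain one, up to
  small errors, which contradicts the ratio.\<close>

lemma exponential_queries:
  fixes k :: nat and \<epsilon> :: real
  assumes k: "2 \<le> k" and \<epsilon>: "0 < \<epsilon>"
  shows "\<exists>c::real. c > 0 \<and> (\<exists>n0::nat. \<forall>A.
    approximation_algorithm k (1 - (1 - 1 / real k) ^ (k - 1) + \<epsilon>) A \<longrightarrow>
    (\<forall>n\<ge>n0. \<exists>f. utility_on {..<n} f \<and> ennreal (exp (c * real n)) \<le> expected_queries A n f))"
proof -
  define \<alpha> where "\<alpha> = 1 - (1 - 1 / real k) ^ (k - 1)"
  \<comment> \<open>\<open>\<eta>\<close> limits the repair term, \<open>\<gamma>\<close> lets it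
    outweigh the interpolation, \<open>q\<close> limits the loss in the hidden optimum,
    \<open>\<delta>\<close> brings the ramp to at least \<open>1 - 3 * q\<close> on the hidden
    classes, and \<open>\<beta>\<close> is the tolerated detection probability.\<close>
  define \<eta> where "\<eta> = min 1 (\<epsilon> / 4)"
  define K where "K = 120 * real k ^ k * (real k)\<^sup>2"
  define \<gamma> where "\<gamma> = min 1 (\<eta> / K)"
  define q where "q = \<epsilon> / (24 * (1 + \<epsilon>))"
  define \<delta> where "\<delta> = min (1 / 16) (exp (ln q / \<gamma>) / (32 * (real k)\<^sup>2))"
  define \<beta> where "\<beta> = min (1 / 2) (\<epsilon> / 24)"
  \<comment> \<open>With \<open>\<tau> = sqrt c\<close> one has
    \<open>k * \<tau>^2 = \<delta>\<close>. A single set is unbalanced with probability of order exp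
    (- 2 c n), so exp (c n) queries are still too few.\<close>
  define c where "c = \<delta> / real k"
  have kpos: "0 < real k" "0 < k"
    using k by auto
  have "(1 - 1 / real k) ^ (k - 1) \<le> 1" "0 \<le> (1 - 1 / real k) ^ (k - 1)"
    using k by (auto intro!: power_le_one)
  then have \<alpha>: "0 \<le> \<alpha>" "\<alpha> \<le> 1"
    by (auto simp: \<alpha>_def)
  have \<eta>: "0 < \<eta>" "\<eta> \<le> 1" "\<eta> \<le> \<epsilon> / 4"
    using \<epsilon> by (auto simp: \<eta>_def)
  have K: "0 < K"
    using kpos by (simp add: K_def)
  have \<gamma>: "0 < \<gamma>" "\<gamma> \<le> 1" "\<gamma> \<le> \<eta> / K"
    using \<eta> K by (auto simp: \<gamma>_def)
  have \<gamma>': "120 * real k ^ k * (real k)\<^sup>2 * \<gamma> \<le> \<eta>"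
    unfolding K_def[symmetric] using \<gamma>(3) K by (simp add: pos_le_divide_eq mult.commute)
  have q: "0 < q" "6 * q * (1 + \<epsilon>) = \<epsilon> / 4"
    using \<epsilon> by (auto simp: q_def field_simps)
  have \<delta>: "0 < \<delta>" "\<delta> \<le> 1 / 16" "\<delta> \<le> exp (ln q / \<gamma>) / (32 * (real k)\<^sup>2)"
    using kpos by (auto simp: \<delta>_def)
  have decay: "exp (\<gamma> * ln (32 * (real k)\<^sup>2 * \<delta>)) \<le> q"
  proof -
    have "32 * (real k)\<^sup>2 * \<delta> \<le> exp (ln q / \<gamma>)"
      using \<delta>(3) kpos by (simp add: pos_le_divide_eq mult.commute)
    then have "ln (32 * (real k)\<^sup>2 * \<delta>) \<le> ln (exp (ln q / \<gamma>))"
      using \<delta>(1) kpos by (subst ln_le_cancel_iff) auto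
    then have "ln (32 * (real k)\<^sup>2 * \<delta>) \<le> ln q / \<gamma>"
      by simp
    then have "\<gamma> * ln (32 * (real k)\<^sup>2 * \<delta>) \<le> ln q"
      using \<gamma>(1) by (simp add: pos_le_divide_eq mult.commute)
    then have "exp (\<gamma> * ln (32 * (real k)\<^sup>2 * \<delta>)) \<le> exp (ln q)"
      by simp
    then show ?thesis
      using q by simp
  qed
  have \<beta>: "0 < \<beta>" "\<beta> < 1" "3 * \<beta> \<le> \<epsilon> / 8"
    using \<epsilon> by (auto simp: \<beta>_def)
  have c: "0 < c" "(sqrt c)\<^sup>2 = c" "real k * (sqrt c)\<^sup>2 \<le> \<delta>"
    using \<delta> kpos by (auto simp: c_def)
  \<comment> \<open>\<open>n0\<close> is so large that
    \<open>2 * W \<le> \<beta> * exp (c * n)\<close>, by \<open>x \<le> exp x\<close>; the averaged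
    detection probability is then at most \<open>\<beta> / 2\<close>.\<close>
  define W where "W = 2 * real k * real (k + 2)"
  obtain n0 :: nat where n0: "2 * W / (\<beta> * c) < real n0"
    using reals_Archimedean2 by blast
  have "\<exists>f. utility_on {..<n} f \<and> ennreal (exp (c * real n)) \<le> expected_queries A n f"
    if A: "approximation_algorithm k (\<alpha> + \<epsilon>) A" and n: "n0 \<le> n" for A n
  proof (rule ccontr)
    assume contra: "\<not> ?thesis"
    have "2 * W / (\<beta> * c) < real n"
      using n0 n by linarith
    then have W: "2 * W < \<beta> * (c * real n)"
      using \<beta> c by (simp add: pos_divide_less_eq mult_ac)
    have W0: "0 < W"
      using kpos by (simp add: W_def)
    have npos: "0 < n"
      using W W0 by (cases n) auto
    let ?p = "plain_utility k \<eta> n"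
    have up: "utility_on {..<n} ?p"
      using k \<eta> by (intro utility_plain_utility) auto
    have run_p: "run_on A n ?p = run ?p (A n)"
      by (simp add: run_on_def)
    have lossless: "lossless_spmf (transcript ?p (A n))"
      using A up by (intro lossless_transcript) (auto simp: approximation_algorithm_def run_p[symmetric])
    have alloc: "\<forall>(S, q, t) \<in> set_spmf (run_on A n ?p). allocation k {..<n} S"
      using A up by (auto simp: approximation_algorithm_def)
    have queries: "(\<integral>\<^sup>+ (S, q, t). of_nat q \<partial>measure_spmf (run ?p (A n))) \<le> ennreal (exp (c * real n))"
      using contra up by (fastforce simp: expected_queries_def run_p not_le)
    have "(\<integral>\<^sup>+ g. emeasure (measure_pmf (transcript ?p (A n))) {x. detects k \<delta> n g x} \<partial>measure_pmf (random_coloring k n))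
        \<le> ennreal (2 * real k * exp (- 2 * (sqrt c)\<^sup>2 * real n)) *
          ((\<integral>\<^sup>+ (S, q, t). of_nat q \<partial>measure_spmf (run ?p (A n))) + of_nat (Suc k))"
      using kpos npos c lossless by (intro detection_probability) auto
    also have "\<dots> \<le> ennreal (2 * real k * exp (- 2 * (sqrt c)\<^sup>2 * real n)) * (ennreal (exp (c * real n)) + of_nat (Suc k))"
      using queries by (intro mult_left_mono add_mono) auto
    also have "\<dots> = ennreal (2 * real k * exp (- 2 * c * real n) * (exp (c * real n) + real (Suc k)))"
      unfolding c(2) by (simp only: ennreal_of_nat_eq_real_of_nat ennreal_plus[symmetric] exp_ge_zero of_nat_0_le_iff)
        (rule ennreal_mult[symmetric], auto)
    also have "\<dots> \<le> ennreal (\<beta> / 2)"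
    proof (rule ennreal_leI)
      define E where "E = exp (c * real n)"
      have E1: "1 \<le> E"
        using c by (simp add: E_def)
      have "c * real n \<le> E"
        unfolding E_def using exp_ge_add_one_self[of "c * real n"] by linarith
      then have "\<beta> * (c * real n) \<le> \<beta> * E"
        using \<beta> by (intro mult_left_mono) auto
      with W have WE: "2 * W \<le> \<beta> * E"
        by linarith
      have "E + real (Suc k) \<le> E + real (Suc k) * E"
        using E1 by simp
      also have "\<dots> = real (k + 2) * E"
        by (simp add: algebra_simps)
      finally have "2 * real k * (E + real (Suc k)) \<le> 2 * real k * (real (k + 2) * E)"
        using kpos by (intro mult_left_mono) auto
      also have "\<dots> = W * E"
        by (simp add: W_def)
      also have "\<dots> \<le> \<beta> / 2 * E * E"
        using WE E1 by (intro mult_right_mono) auto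
      finally have "2 * real k * (E + real (Suc k)) \<le> \<beta> / 2 * E * E" .
      moreover have "exp (- 2 * c * real n) = 1 / (E * E)"
        by (simp add: E_def exp_minus exp_add[symmetric] inverse_eq_divide[symmetric])
      ultimately show "2 * real k * exp (- 2 * c * real n) * (exp (c * real n) + real (Suc k)) \<le> \<beta> / 2"
        using E1 unfolding E_def[symmetric] by (simp add: divide_le_eq mult_ac)
    qed
    finally have avg: "(\<integral>\<^sup>+ g. emeasure (measure_pmf (transcript ?p (A n))) {x. detects k \<delta> n g x} \<partial>measure_pmf (random_coloring k n))
        \<le> ennreal (\<beta> / 2)" .
    \<comment> \<open>The average over the colorings is at most \<open>\<beta> / 2\<close>, so some
      coloring stays below \<open>\<beta>\<close>.\<close>
    have "\<exists>g\<in>set_pmf (random_coloring k n). emeasure (measure_pmf (transcript ?p (A n))) {x. detects k \<delta> n g x} \<le> ennreal \<beta>"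
    proof (rule ccontr)
      assume "\<not> ?thesis"
      then have "(\<integral>\<^sup>+ g. ennreal \<beta> \<partial>measure_pmf (random_coloring k n)) \<le>
        (\<integral>\<^sup>+ g. emeasure (measure_pmf (transcript ?p (A n))) {x. detects k \<delta> n g x} \<partial>measure_pmf (random_coloring k n))"
        by (intro nn_integral_mono_AE AE_pmfI) (auto simp: not_le intro: less_imp_le)
      then have "ennreal \<beta> \<le> ennreal (\<beta> / 2)"
        using avg by simp
      then show False
        using \<beta> by (simp add: ennreal_le_iff)
    qed
    then obtain g where g: "g \<in> set_pmf (random_coloring k n)"
      and det: "emeasure (measure_pmf (transcript ?p (A n))) {x. detects k \<delta> n g x} \<le> ennreal \<beta>"
      by blast
    have gk: "g ` {..<n} \<subseteq> {..<k}"
      using g kpos by (intro set_random_coloring) auto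
    \<comment> \<open>The empty set is among the tested sets; if it were unbalanced, detection would
      be certain, against \<open>\<beta> < 1\<close>.\<close>
    have bal: "dispersion k (class_left_over n g {}) \<le> \<delta>"
    proof (rule ccontr)
      assume "\<not> ?thesis"
      then have "{x. detects k \<delta> n g x} = UNIV"
        by (auto simp: detects_def unbalanced_def split: option.splits)
      then have "1 \<le> ennreal \<beta>"
        using det by simp
      then show False
        using \<beta> by simp
    qed
    let ?h = "hidden_utility k \<gamma> \<delta> \<eta> n g"
    have uh: "utility_on {..<n} ?h"
      using k gk \<delta> \<gamma> \<gamma>' \<eta> by (intro utility_hidden_utility) auto
    have opt: "real k - 6 * real k * q \<le> opt_welfare k {..<n} (\<lambda>_. ?h)"
      using k gk npos \<delta> \<gamma> \<eta> bal decay by (intro hidden_opt_ge) auto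
    have "(\<alpha> + \<epsilon>) * (real k - 6 * real k * q) \<le> (\<alpha> + \<epsilon>) * opt_welfare k {..<n} (\<lambda>_. ?h)"
      using opt \<alpha> \<epsilon> by (intro mult_left_mono) auto
    also have "\<dots> \<le> (\<integral>(S, q, t). welfare k (\<lambda>_. ?h) S \<partial>measure_spmf (run_on A n ?h))"
      using A uh by (simp add: approximation_algorithm_def)
    also have "\<dots> \<le> real k * \<alpha> + real k * \<eta> + 3 * real k * \<beta>"
      unfolding \<alpha>_def using k npos gk \<delta> \<gamma> \<eta> alloc det \<beta> by (intro hidden_welfare_le) auto
    finally have "real k * ((\<alpha> + \<epsilon>) * (1 - 6 * q)) \<le> real k * (\<alpha> + \<eta> + 3 * \<beta>)"
      by (simp add: algebra_simps)
    then have "(\<alpha> + \<epsilon>) * (1 - 6 * q) \<le> \<alpha> + \<eta> + 3 * \<beta>"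
      using kpos by simp
    moreover have "6 * q * (\<alpha> + \<epsilon>) \<le> 6 * q * (1 + \<epsilon>)"
      using q \<alpha> by (intro mult_left_mono) auto
    \<comment> \<open>The losses through \<open>q\<close>, \<open>\<eta>\<close> and
      \<open>\<beta>\<close> are at most \<open>\<epsilon> / 4\<close>,
      \<open>\<epsilon> / 4\<close> and \<open>\<epsilon> / 8\<close>, together less than
      \<open>\<epsilon>\<close>.\<close>
    ultimately show False
      using q(2) \<eta>(3) \<beta>(3) \<epsilon> by (simp add: algebra_simps)
  qed
  then show ?thesis
    using c(1) unfolding \<alpha>_def by blast
qed

theorem theorem1p6:
  fixes k :: nat
  assumes "2 \<le> k"
  shows "(\<exists>P. approximation_algorithm k (1 - (1 - 1 / real k) ^ (k - 1)) (program_alg P) \<and>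
              linear_time (program_alg P)) \<and>
         (\<forall>\<epsilon>::real. \<epsilon> > 0 \<longrightarrow>
            (\<exists>c::real. c > 0 \<and> (\<exists>n0::nat. \<forall>A.
               approximation_algorithm k (1 - (1 - 1 / real k) ^ (k - 1) + \<epsilon>) A \<longrightarrow>
               (\<forall>n\<ge>n0. \<exists>f. utility_on {..<n} f \<and>
                  ennreal (exp (c * real n)) \<le> expected_queries A n f))))"
proof (intro conjI allI impI)
  show "\<exists>P. approximation_algorithm k (1 - (1 - 1 / real k) ^ (k - 1)) (program_alg P) \<and>
      linear_time (program_alg P)"
    using approximation_random_allocation[OF assms] linear_time_random_allocation by blast
qed (rule exponential_queries[OF assms])

end
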